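(* Let $P\not\equiv 0$ be a real polynomial in $n$ variables and let $\vec x_0\in\mathbb{R}^n$ satisfy $P(\vec x_0)=|\vec\nabla P(\vec x_0)|=0$. Let $p,q$ be positive integers with $p/q=\theta\in\mathbf{\Theta}$, let $r>0$ and $C>0$ be such that $|P(\vec x)|^{\theta}\le C|\vec\nabla P(\vec x)|$ whenever $|\vec x-\vec x_0|<r$, and let $N/D$ be the reduced form of $P^{2p}/|\vec\nabla P|^{2q}$. Define functions $f,g:\mathbb{R}^n\to\mathbb{R}$ by $$f(\vec x)=\begin{cases}\dfrac{N(\vec x)}{D(\vec x)} & \text{for }\vec x\notin\mathcal{Z}(D),\\[2mm] 0 & \text{for }\vec x\in\mathcal{Z}(D),\end{cases}\qquad g(\vec x)=\begin{cases}\dfrac{(P(\vec x))^{2p}}{|\vec\nabla P(\vec x)|^{2q}} & \text{for }\vec\nabla P(\vec x)\ne\vec 0,\\[2mm] 0 & \text{for }\vec\nabla P(\vec x)=\vec 0.\end{cases}$$ Then $f$ and $g$ are bounded on $B_r(\vec x_0)$, and further: (1) If $p/q>\theta_0$, then $f$ and $g$ are equal and continuous on $B_{r'}(\vec x_0)$ for some $0<r'\le r$. (2) If $p/q=\theta_0$, then $g$ is not continuous on any ball $B_{r'}(\vec x_0)$, $r'>0$. (3) If $p/q=\theta_0$, and $\vec x_0$ is an isolated critical point of $P$, and $D(\vec x_0)=0$, then $f$ is not continuous on any ball $B_{r'}(\vec x_0)$, $r'>0$.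
   Context: For a real polynomial $F$ in $n$ variables, $\mathcal{Z}(F)=\{\vec x\in\mathbb{R}^n: F(\vec x)=0\}$. $B_r(\vec x_0)$ is the open Euclidean ball of radius $r$ and center $\vec x_0$. $\vec\nabla P$ is the gradient of $P$ and $|\cdot|$ is the Euclidean norm, so $|\vec\nabla P|^2$ is a polynomial; a critical point of $P$ is a point where $\vec\nabla P=\vec 0$. For $P\not\equiv 0$ and $\vec x_0$ with $P(\vec x_0)=0$, $\vec\nabla P(\vec x_0)=\vec 0$, define $$\mathbf{\Theta}=\left\{\theta>0:\ \exists\, r>0\ \exists\, C>0:\ |\vec x-\vec x_0|<r\implies |P(\vec x)|^\theta\le C\,|\vec\nabla P(\vec x)|\right\}\subseteq\mathbb{R},$$ and let $\theta_0$ be the greatest lower bound of $\mathbf{\Theta}$ (both depend on $P$ and $\vec x_0$). Reduced form: given $P$, $p$, $q$, write $P^{2p}=F\cdot N$ and $|\vec\nabla P|^{2q}=F\cdot D$ in the polynomial ring $\mathbb{R}[x_1,\ldots,x_n]$, where $F$ is the product of all common irreducible factors (with multiplicity), i.e. a greatest common divisor, so that $N$ and $D$ have no non-constant common factor; if $P^{2p}$ and $|\vec\nabla P|^{2q}$ have no common factors, take $F=1$, and if $|\vec\nabla P|^{2q}$ divides $P^{2p}$, take $D=1$. Then $N/D$ is called the reduced form of $P^{2p}/|\vec\nabla P|^{2q}$. *)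

theory Defs
  imports "HOL-Analysis.Analysis" "HOL-Library.Poly_Mapping"
begin

text \<open>The polynomial ring over the reals in finitely many variables, one for each element of the
  type \<open>'n\<close>: a monomial is its exponent vector of type \<open>'n \<Rightarrow>\<^sub>0 nat\<close>, a polynomial maps monomials
  to coefficients, and the ring operations and divisibility are those of \<open>Poly_Mapping\<close>.\<close>

type_synonym 'n rpoly = "('n \<Rightarrow>\<^sub>0 nat) \<Rightarrow>\<^sub>0 real"

definition eval_monom :: "('n::finite \<Rightarrow>\<^sub>0 nat) \<Rightarrow> real ^ 'n \<Rightarrow> real" where
  "eval_monom m x = (\<Prod>i\<in>UNIV. (x $ i) ^ Poly_Mapping.lookup m i)"

definition eval_poly :: "'n::finite rpoly \<Rightarrow> real ^ 'n \<Rightarrow> real" where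
  "eval_poly P x = (\<Sum>m\<in>Poly_Mapping.keys P. Poly_Mapping.lookup P m * eval_monom m x)"

definition zero_locus :: "'n::finite rpoly \<Rightarrow> (real ^ 'n) set" where
  "zero_locus P = {x. eval_poly P x = 0}"

text \<open>Formal partial derivative. Subtraction of exponent vectors is truncated, which is harmless:
  when the exponent of \<open>i\<close> in \<open>m\<close> is \<open>0\<close>, the coefficient is \<open>0\<close>.\<close>

definition partial_poly :: "'n \<Rightarrow> 'n rpoly \<Rightarrow> 'n rpoly" where
  "partial_poly i P =
     (\<Sum>m\<in>Poly_Mapping.keys P. Poly_Mapping.single (m - Poly_Mapping.single i 1)
        (real (Poly_Mapping.lookup m i) * Poly_Mapping.lookup P m))"

definition grad_poly :: "'n::finite rpoly \<Rightarrow> real ^ 'n \<Rightarrow> real ^ 'n" where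
  "grad_poly P x = (\<chi> i. eval_poly (partial_poly i P) x)"

text \<open>The squared norm of the gradient as an element of the polynomial ring.\<close>

definition grad_sq_poly :: "'n::finite rpoly \<Rightarrow> 'n rpoly" where
  "grad_sq_poly P = (\<Sum>i\<in>UNIV. (partial_poly i P)\<^sup>2)"

definition loj_exponents :: "'n::finite rpoly \<Rightarrow> real ^ 'n \<Rightarrow> real set" where
  "loj_exponents P x0 =
     {\<theta>. \<theta> > 0 \<and> (\<exists>r>0. \<exists>C>0. \<forall>x. norm (x - x0) < r \<longrightarrow>
        \<bar>eval_poly P x\<bar> powr \<theta> \<le> C * norm (grad_poly P x))}"

definition loj_exponent :: "'n::finite rpoly \<Rightarrow> real ^ 'n \<Rightarrow> real" where
  "loj_exponent P x0 = Inf (loj_exponents P x0)"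

text \<open>\<open>N / D\<close> is a reduced form of \<open>A / B\<close>: a greatest common divisor \<open>F\<close> (in the sense of
  divisibility, hence determined up to a nonzero constant) is cancelled, with \<open>F = 1\<close> if \<open>A\<close> and
  \<open>B\<close> have no non-constant common factor, and \<open>D = 1\<close> if \<open>B\<close> divides \<open>A\<close>. The units of the
  polynomial ring are the nonzero constants.\<close>

definition is_reduced_form ::
    "'n::finite rpoly \<Rightarrow> 'n rpoly \<Rightarrow> 'n rpoly \<Rightarrow> 'n rpoly \<Rightarrow> bool" where
  "is_reduced_form A B N D \<longleftrightarrow>
     (\<exists>F. A = F * N \<and> B = F * D \<and>
          (\<forall>G. G dvd A \<longrightarrow> G dvd B \<longrightarrow> G dvd F) \<and>
          ((\<forall>G. G dvd A \<longrightarrow> G dvd B \<longrightarrow> G dvd 1) \<longrightarrow> F = 1) \<and>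
          (B dvd A \<longrightarrow> D = 1))"


text \<open>The following facts confirm that \<open>eval_poly\<close> is a ring homomorphism and that the formally
  defined gradient is the analytic one.\<close>

lemma eval_poly_superset:
  assumes "finite S" "Poly_Mapping.keys P \<subseteq> S"
  shows "eval_poly P x = (\<Sum>m\<in>S. Poly_Mapping.lookup P m * eval_monom m x)"
  unfolding eval_poly_def
  by (rule sum.mono_neutral_left) (use assms in \<open>auto simp: in_keys_iff\<close>)

lemma eval_poly_0 [simp]: "eval_poly 0 x = 0"
  by (simp add: eval_poly_def)

lemma eval_poly_single [simp]: "eval_poly (Poly_Mapping.single m c) x = c * eval_monom m x"
  by (simp add: eval_poly_superset[of "{m}"])

lemma eval_poly_add [simp]: "eval_poly (P + Q) x = eval_poly P x + eval_poly Q x"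
  by (simp add: eval_poly_superset[of "Poly_Mapping.keys P \<union> Poly_Mapping.keys Q"] keys_add lookup_add
      distrib_right sum.distrib)

lemma eval_poly_sum [simp]: "eval_poly (sum f A) x = (\<Sum>a\<in>A. eval_poly (f a) x)"
  by (induction A rule: infinite_finite_induct) auto

lemma eval_monom_0 [simp]: "eval_monom 0 x = 1"
  by (simp add: eval_monom_def)

lemma eval_poly_1 [simp]: "eval_poly 1 x = 1"
  using eval_poly_single[of 0 1 x] by simp

lemma eval_monom_add: "eval_monom (m + m') x = eval_monom m x * eval_monom m' x"
  by (simp add: eval_monom_def lookup_add power_add prod.distrib)

lemma rpoly_expand: "P = (\<Sum>m\<in>Poly_Mapping.keys P. Poly_Mapping.single m (Poly_Mapping.lookup P m))"
  by (rule poly_mapping_eqI)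
     (auto simp: lookup_sum lookup_single when_def sum.delta in_keys_iff)

lemma eval_poly_mult [simp]: "eval_poly (P * Q) x = eval_poly P x * eval_poly Q x"
proof -
  have "P * Q = (\<Sum>m\<in>Poly_Mapping.keys P. \<Sum>m'\<in>Poly_Mapping.keys Q.
      Poly_Mapping.single (m + m') (Poly_Mapping.lookup P m * Poly_Mapping.lookup Q m'))"
    by (subst (1) rpoly_expand[of P], subst (1) rpoly_expand[of Q])
       (simp add: sum_product mult_single)
  then show ?thesis
    by (simp add: eval_poly_def[of P] eval_poly_def[of Q] sum_product eval_monom_add mult_ac)
qed

lemma eval_poly_power [simp]: "eval_poly (P ^ k) x = eval_poly P x ^ k"
  by (induction k) auto

lemma eval_grad_sq_poly: "eval_poly (grad_sq_poly P) x = (norm (grad_poly P x))\<^sup>2"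
  unfolding power2_norm_eq_inner
  by (simp add: grad_sq_poly_def inner_vec_def grad_poly_def power2_eq_square)

lemma eval_monom_deriv:
  "(eval_monom m has_derivative
     (\<lambda>h. \<Sum>i\<in>UNIV. h $ i * (real (Poly_Mapping.lookup m i) * eval_monom (m - Poly_Mapping.single i 1) x))) (at x)"
proof -
  have split: "eval_monom (m - Poly_Mapping.single i 1) x =
      (x $ i) ^ (Poly_Mapping.lookup m i - 1) * (\<Prod>j\<in>UNIV - {i}. (x $ j) ^ Poly_Mapping.lookup m j)" for i
    unfolding eval_monom_def
    by (subst prod.remove[of UNIV i]) (auto simp: lookup_minus lookup_single when_def intro!: prod.cong)
  have "((\<lambda>x. \<Prod>i\<in>UNIV. (x $ i) ^ Poly_Mapping.lookup m i) has_derivative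
      (\<lambda>h. \<Sum>i\<in>UNIV. (of_nat (Poly_Mapping.lookup m i) * h $ i * (x $ i) ^ (Poly_Mapping.lookup m i - 1)) *
         (\<Prod>j\<in>UNIV - {i}. (x $ j) ^ Poly_Mapping.lookup m j))) (at x)"
    by (rule has_derivative_prod has_derivative_power
        bounded_linear.has_derivative[OF bounded_linear_vec_nth] has_derivative_ident)+
  then show ?thesis
    unfolding split by (simp add: eval_monom_def[abs_def] mult_ac)
qed

lemma eval_poly_GDERIV: "GDERIV (eval_poly P) x :> grad_poly P x"
proof -
  have "((\<lambda>x. \<Sum>m\<in>Poly_Mapping.keys P. Poly_Mapping.lookup P m * eval_monom m x) has_derivative
      (\<lambda>h. \<Sum>m\<in>Poly_Mapping.keys P. Poly_Mapping.lookup P m * (\<Sum>i\<in>UNIV. h $ i *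
         (real (Poly_Mapping.lookup m i) * eval_monom (m - Poly_Mapping.single i 1) x)))) (at x)"
    by (intro has_derivative_sum has_derivative_mult_right eval_monom_deriv)
  moreover have "(\<Sum>m\<in>Poly_Mapping.keys P. Poly_Mapping.lookup P m * (\<Sum>i\<in>UNIV. h $ i *
         (real (Poly_Mapping.lookup m i) * eval_monom (m - Poly_Mapping.single i 1) x))) = h \<bullet> grad_poly P x" for h
    by (simp add: inner_vec_def grad_poly_def partial_poly_def sum_distrib_left mult_ac)
       (rule sum.swap)
  ultimately show ?thesis
    unfolding gderiv_def by (simp add: eval_poly_def[abs_def])
qed

end

theory Submission
  imports Defs
begin

text \<open>
  Off the critical set \<open>f\<close> and \<open>g\<close> agree, and the critical set has empty interior near \<open>x0\<close>; so bounds
  and continuity pass from \<open>g\<close> to \<open>f\<close>, and (3) reduces to (2). For (1), an exponent \<open>\<theta>' < p / q\<close> in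
  \<open>\<Theta>\<close> gives \<open>g \<le> C \<bar>P\<bar> powr (2 p - 2 q \<theta>')\<close>.

  For (2), if \<open>g\<close> were continuous near \<open>x0\<close>, a Lojasiewicz inequality \<open>g\<^sup>m \<le> K P\<^sup>2\<close> would hold near \<open>x0\<close>,
  which puts \<open>(p m - 1) / (q m) < p / q\<close> into \<open>\<Theta>\<close>. To get it, consider the set \<open>U\<close> of all \<open>(t, s)\<close> with
  \<open>0 < s \<le> g x\<close> and \<open>P(x)\<^sup>2 \<le> t\<close> for some \<open>x\<close> in a closed ball. By quantifier elimination
  membership in \<open>U\<close> depends only on the signs of finitely many real polynomials in \<open>t\<close> and \<open>s\<close>, hence the upper
  boundary \<open>s = \<phi>(t)\<close> satisfies a nontrivial polynomial equation; as \<open>\<phi>(t) \<rightarrow> 0\<close>, this forces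
  \<open>\<phi>(t)\<^sup>m \<le> K t\<close>.

  Quantifier elimination follows Cohen and Hoermander: in a family closed under derivatives,
  truncations and pseudo-remainders, equal signs of all coefficients at two parameters yield
  an increasing bijection of the line that matches the signs of all polynomials of the family.
\<close>

section \<open>Sign-preserving bijections of the line\<close>

text \<open>Points are added in increasing order, so each new point lies to the right of all earlier
  ones and only the right-hand tail of the bijection has to be redefined.\<close>

lemma strict_mono_extend:
  fixes k :: "real \<Rightarrow> real"
  assumes "finite S" "strict_mono_on S k"
  shows "\<exists>H. strict_mono H \<and> surj H \<and> (\<forall>a\<in>S. H a = k a)"
  using assms
proof (induction S rule: finite_linorder_max_induct)
  case empty
  have "strict_mono (id :: real \<Rightarrow> real) \<and> surj (id :: real \<Rightarrow> real)"
    by (simp add: strict_mono_def)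
  then show ?case by blast
next
  case (insert b A)
  show ?case
  proof (cases "A = {}")
    case True
    have "surj (\<lambda>t. t - b + k b)"
      by (rule surjI[of _ "\<lambda>y. y + b - k b"]) simp
    then have "strict_mono (\<lambda>t. t - b + k b) \<and> surj (\<lambda>t. t - b + k b) \<and> (\<forall>a\<in>insert b A. a - b + k b = k a)"
      using True by (auto simp: strict_mono_def)
    then show ?thesis by blast
  next
    case False
    have "strict_mono_on A k"
      using insert.prems by (auto simp: strict_mono_on_def)
    then obtain H where H: "strict_mono H" "surj H" "\<forall>a\<in>A. H a = k a"
      using insert.IH by blast
    define a where "a = Max A"
    have a: "a \<in> A" "\<And>t. t \<in> A \<Longrightarrow> t \<le> a"
      using False insert.hyps by (auto simp: a_def)
    have ab: "a < b" using a insert.hyps by auto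
    have kab: "k a < k b"
      using insert.prems a ab by (auto simp: strict_mono_on_def)
    define c where "c = (k b - k a) / (b - a)"
    have c: "c > 0" "(b - a) * c = k b - k a" using ab kab by (auto simp: c_def)
    \<comment> \<open>Keep \<open>H\<close> up to the largest old point \<open>a\<close>; the slope
      \<open>c\<close> of the new tail is chosen so that it reaches \<open>k b\<close> at
      \<open>b\<close>.\<close>
    define H' where "H' t = (if t \<le> a then H t else k a + (t - a) * c)" for t
    have Ha: "H a = k a" using H a by auto
    have "strict_mono H'"
    proof (rule strict_monoI)
      fix s t :: real assume st: "s < t"
      consider "t \<le> a" | "s \<le> a" "t > a" | "s > a" using st by linarith
      then show "H' s < H' t"
      proof cases
        case 1 then show ?thesis using st H(1) by (auto simp: H'_def strict_mono_def)
      next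
        case 2
        have "H s \<le> k a" using H(1) 2 Ha by (metis strict_mono_less_eq)
        moreover have "(t - a) * c > 0" using 2 c by simp
        ultimately show ?thesis using 2 by (simp add: H'_def)
      next
        case 3 then show ?thesis using st c by (auto simp: H'_def)
      qed
    qed
    moreover have "surj H'"
    proof -
      have "\<exists>t. H' t = y" for y
      proof (cases "y \<le> k a")
        case True
        obtain t where t: "H t = y" using H(2) unfolding surj_def by metis
        then have "t \<le> a" using True Ha H(1) by (metis strict_mono_less_eq)
        then show ?thesis using t by (auto simp: H'_def)
      next
        case False
        then have "H' (a + (y - k a) / c) = y" using c by (auto simp: H'_def field_simps)
        then show ?thesis by blast
      qed
      then show ?thesis unfolding surj_def by metis
    qed
    moreover have "\<forall>t\<in>insert b A. H' t = k t"
      using H(3) a ab c by (auto simp: H'_def)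
    ultimately show ?thesis by blast
  qed
qed

text \<open>By the intermediate value theorem a change of sign would force a root.
  \<open>closed_segment\<close> admits the endpoints in either order.\<close>

lemma sgn_poly_eq_if_no_root:
  fixes p :: "real poly"
  assumes "\<And>t. t \<in> closed_segment a b \<Longrightarrow> poly p t \<noteq> 0"
  shows "sgn (poly p a) = sgn (poly p b)"
proof -
  have *: "sgn (poly p a) = sgn (poly p b)"
    if "a \<le> b" and n: "\<And>t. a \<le> t \<Longrightarrow> t \<le> b \<Longrightarrow> poly p t \<noteq> 0" for a b
  proof (cases "a = b")
    case False
    then have ab: "a < b" using that by simp
    show ?thesis
    proof (rule ccontr)
      assume "\<not> ?thesis"
      moreover have "poly p a \<noteq> 0" "poly p b \<noteq> 0" using n that by auto
      ultimately have "poly p a * poly p b < 0"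
        by (cases "poly p a" "0::real" rule: linorder_cases; cases "poly p b" "0::real" rule: linorder_cases)
           (simp_all add: mult_less_0_iff)
      from poly_IVT[OF ab this] n show False by (meson less_imp_le)
    qed
  qed auto
  show ?thesis
  proof (cases "a \<le> b")
    case True
    then show ?thesis using assms by (intro *) (simp_all add: closed_segment_eq_real_ivl)
  next
    case False
    then show ?thesis using assms by (intro *[symmetric]) (simp_all add: closed_segment_eq_real_ivl)
  qed
qed

lemma poly_rolle:
  fixes p :: "real poly"
  assumes "a < b" "poly p a = poly p b"
  shows "\<exists>t. a < t \<and> t < b \<and> poly (pderiv p) t = 0"
  using poly_MVT[OF assms(1), of p] assms by auto

lemma eventually_sgn_poly_at_top:
  fixes p :: "real poly"
  assumes "p \<noteq> 0"
  shows "\<forall>\<^sub>F t in at_top. sgn (poly p t) = sgn (lead_coeff p)"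
proof -
  have pos: "\<forall>\<^sub>F t in at_top. sgn (poly p t) = sgn (lead_coeff p)" if pos: "lead_coeff p > 0" for p :: "real poly"
  proof -
    obtain n where "\<And>x. x \<ge> n \<Longrightarrow> poly p x \<ge> lead_coeff p" using poly_pinfty_gt_lc pos by metis
    then show ?thesis
      using pos by (intro eventually_at_top_linorderI[of n]) (metis less_le_trans sgn_pos)
  qed
  consider "lead_coeff p > 0" | "lead_coeff (-p) > 0"
    using assms by (cases "lead_coeff p" "0::real" rule: linorder_cases) (auto simp: lead_coeff_minus)
  then show ?thesis
    using pos[of p] pos[of "-p"] by cases (auto simp: sgn_minus)
qed

text \<open>Reflecting the variable reduces this to the behaviour at plus infinity.\<close>

lemma eventually_sgn_poly_at_bot:
  fixes p :: "real poly"
  assumes "p \<noteq> 0"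
  shows "\<forall>\<^sub>F t in at_bot. sgn (poly p t) = sgn (lead_coeff p) * (-1) ^ degree p"
proof -
  let ?m = "[:0, -1::real:]"
  have "pcompose p ?m \<noteq> 0" using assms by (simp add: pcompose_eq_0_iff)
  from eventually_sgn_poly_at_top[OF this]
  have "\<forall>\<^sub>F t in at_top. sgn (poly p (- t)) = sgn (lead_coeff p) * (-1) ^ degree p"
    by (simp add: poly_pcompose lead_coeff_comp sgn_mult)
  then show ?thesis by (simp add: at_bot_mirror eventually_filtermap)
qed

text \<open>In the applications \<open>R\<close> contains all critical points of a polynomial, which
  is then strictly monotone between \<open>a\<close> and \<open>b\<close>.\<close>

lemma finite_gap:
  fixes R :: "'a::linorder set"
  assumes "finite R" "a0 \<in> R" "b0 \<in> R" "a0 \<le> t" "t \<le> b0" "t \<notin> R"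
  obtains a b where "a \<in> R" "b \<in> R" "a < t" "t < b" "\<And>c. c \<in> R \<Longrightarrow> c \<le> a \<or> b \<le> c"
proof -
  define a where "a = Max {a\<in>R. a < t}"
  define b where "b = Min {b\<in>R. t < b}"
  have neq: "a0 \<noteq> t" "b0 \<noteq> t" using assms by auto
  have a: "a \<in> {a\<in>R. a < t}" unfolding a_def using assms neq by (intro Max_in) auto
  have b: "b \<in> {b\<in>R. t < b}" unfolding b_def using assms neq by (intro Min_in) auto
  have "c \<le> a \<or> b \<le> c" if "c \<in> R" for c
  proof (cases "c < t")
    case True
    then show ?thesis unfolding a_def using assms(1) that by simp
  next
    case False
    then have "t < c" using that assms(6) by (metis not_less_iff_gr_or_eq)
    then show ?thesis unfolding b_def using assms(1) that by simp
  qed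
  with a b that show thesis by blast
qed

lemma less_iff_of_sgn_diff_eq:
  fixes x y u v :: real
  assumes "sgn (x - y) = sgn (u - v)"
  shows "(x < y \<longleftrightarrow> u < v) \<and> (x = y \<longleftrightarrow> u = v) \<and> (y < x \<longleftrightarrow> v < u)"
  using assms
  by (cases x y rule: linorder_cases; cases u v rule: linorder_cases) simp_all

text \<open>A root \<open>z\<close> outside \<open>R\<close> lies in a gap of \<open>R\<close>,
  where \<open>f\<close> has no critical point. So \<open>f\<close> has opposite signs at the two
  ends of the gap; these signs pass to \<open>g\<close> at the images of the ends, and the
  intermediate value theorem gives a root of \<open>g\<close> between them.\<close>

lemma root_transfer:
  fixes f g :: "real poly"
  assumes R: "finite R" and h: "strict_mono h"
    and crit: "\<And>t. poly (pderiv f) t = 0 \<Longrightarrow> t \<in> R"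
    and sg: "\<And>a. a \<in> R \<Longrightarrow> sgn (poly f a) = sgn (poly g (h a))"
    and z: "poly f z = 0" "a0 \<in> R" "a0 \<le> z" "b0 \<in> R" "z \<le> b0"
  shows "\<exists>z'. poly g z' = 0 \<and> (\<forall>a\<in>R. sgn (z - a) = sgn (z' - h a))"
proof (cases "z \<in> R")
  case True
  have "poly g (h z) = 0" using sg[OF True] z by (simp add: sgn_0_0)
  moreover have "sgn (z - a) = sgn (h z - h a)" for a
    using strict_monoD[OF h, of a z] strict_monoD[OF h, of z a]
    by (cases a z rule: linorder_cases) simp_all
  ultimately show ?thesis by blast
next
  case False
  obtain a b where a: "a \<in> R" "a < z" and b: "b \<in> R" "z < b"
    and gap: "\<And>t. t \<in> R \<Longrightarrow> t \<le> a \<or> b \<le> t"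
    using finite_gap[OF R z(2) z(4) z(3) z(5) False] by metis
  have cr: "poly (pderiv f) t \<noteq> 0" if "a < t" "t < b" for t
    using crit[of t] gap[of t] that by auto
  \<comment> \<open>As \<open>f\<close> vanishes at \<open>z\<close>, the mean value theorem on both
    sides of \<open>z\<close> expresses \<open>poly f a\<close> and \<open>poly f b\<close> through
    values of the derivative, whose sign is constant in the gap.\<close>
  obtain u where u: "a < u" "u < z" "poly f z - poly f a = (z - a) * poly (pderiv f) u"
    using poly_MVT[OF a(2)] by blast
  obtain v where v: "z < v" "v < b" "poly f b - poly f z = (b - z) * poly (pderiv f) v"
    using poly_MVT[OF b(2)] by blast
  have "sgn (poly (pderiv f) u) = sgn (poly (pderiv f) v)"
    using u v by (intro sgn_poly_eq_if_no_root cr) (auto simp: closed_segment_eq_real_ivl split: if_splits)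
  moreover have "sgn (poly f a) = - sgn (poly (pderiv f) u)"
  proof -
    have "poly f a = - ((z - a) * poly (pderiv f) u)" using u z by simp
    then show ?thesis using a by (simp add: sgn_mult sgn_minus)
  qed
  moreover have "sgn (poly f b) = sgn (poly (pderiv f) v)"
  proof -
    have "poly f b = (b - z) * poly (pderiv f) v" using v z by simp
    then show ?thesis using b by (simp add: sgn_mult)
  qed
  moreover have "poly (pderiv f) v \<noteq> 0" using cr v a by auto
  ultimately have "sgn (poly g (h a)) = - sgn (poly g (h b))" "poly g (h b) \<noteq> 0"
    using sg[OF a(1)] sg[OF b(1)] by (auto simp: sgn_0_0)
  then have "poly g (h a) * poly g (h b) < 0"
    by (cases "poly g (h a)" "0::real" rule: linorder_cases; cases "poly g (h b)" "0::real" rule: linorder_cases)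
       (simp_all add: mult_less_0_iff)
  moreover have "h a < h b" using h a b by (auto simp: strict_mono_def)
  ultimately obtain z' where z': "h a < z'" "z' < h b" "poly g z' = 0"
    using poly_IVT by blast
  have "sgn (z - c) = sgn (z' - h c)" if "c \<in> R" for c
    using gap[OF that]
  proof
    assume "c \<le> a"
    then have "h c \<le> h a" using h by (simp add: strict_mono_less_eq)
    then show ?thesis using \<open>c \<le> a\<close> a z' by simp
  next
    assume "c \<ge> b"
    then have "h c \<ge> h b" using h by (simp add: strict_mono_less_eq)
    then show ?thesis using \<open>c \<ge> b\<close> b z' by simp
  qed
  then show ?thesis using z' by blast
qed

text \<open>The bijection \<open>h\<close> already matches \<open>f\<close> and \<open>g\<close> at all roots of the \<open>p i\<close>, in particular at the
  critical points of \<open>f\<close>; between those, \<open>f\<close> has at most one root, which \<open>H\<close> sends to the root of \<open>g\<close>.\<close>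

lemma sign_iso_step:
  fixes p q :: "'i \<Rightarrow> real poly" and f g :: "real poly" and h :: "real \<Rightarrow> real"
  assumes I: "finite I" "\<And>i. i \<in> I \<Longrightarrow> p i \<noteq> 0"
    and h: "strict_mono h" "surj h"
    and sg: "\<And>i t. i \<in> I \<Longrightarrow> sgn (poly (p i) t) = sgn (poly (q i) (h t))"
    and sf: "\<And>i t. i \<in> I \<Longrightarrow> poly (p i) t = 0 \<Longrightarrow> sgn (poly f t) = sgn (poly g (h t))"
    and j: "j \<in> I" "p j = pderiv f" "q j = pderiv g"
    and nz: "f \<noteq> 0" "g \<noteq> 0"
    and deg: "degree f = degree g"
    and lc: "sgn (lead_coeff f) = sgn (lead_coeff g)"
  shows "\<exists>H. strict_mono H \<and> surj H \<and> (\<forall>i\<in>I. \<forall>t. sgn (poly (p i) t) = sgn (poly (q i) (H t)))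
    \<and> (\<forall>t. sgn (poly f t) = sgn (poly g (H t)))"
proof -
  define hi where "hi = inv h"
  have hhi [simp]: "h (hi y) = y" for y unfolding hi_def using h(2) by (rule surj_f_inv_f)
  have hih [simp]: "hi (h t) = t" for t
    unfolding hi_def using h(1) by (simp add: strict_mono_imp_inj_on inv_f_f)
  have hi: "strict_mono hi"
    by (rule strict_monoI) (metis h(1) hhi strict_mono_less)
  define R0 where "R0 = (\<Union>i\<in>I. {t. poly (p i) t = 0})"
  define Z where "Z = {t. poly f t = 0}"
  define Z' where "Z' = {t. poly g t = 0}"
  \<comment> \<open>These are the points that the sample points \<open>a0\<close> and
    \<open>b0\<close> must enclose; roots of \<open>g\<close> are pulled back along
    \<open>h\<close>.\<close>
  define W where "W = R0 \<union> Z \<union> hi ` Z'"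
  have fin: "finite R0" "finite Z" "finite Z'" "finite W"
    using I nz by (auto simp: R0_def Z_def Z'_def W_def poly_roots_finite)
  have hbot: "filterlim h at_bot at_bot"
    unfolding filterlim_at_bot eventually_at_bot_linorder
    by (metis h(1) hhi strict_mono_less_eq)
  have htop: "filterlim h at_top at_top"
    unfolding filterlim_at_top eventually_at_top_linorder
    by (metis h(1) hhi strict_mono_less_eq)
  have "\<forall>\<^sub>F t in at_bot. \<forall>w\<in>W. t < w"
    using fin(4) by (intro eventually_ball_finite) auto
  \<comment> \<open>Far out, degree and sign of the leading coefficient fix the signs of
    \<open>f\<close> and \<open>g\<close>, and both data agree. So \<open>a0\<close>, and likewise
    \<open>b0\<close>, can serve as further points where the signs match under
    \<open>h\<close>.\<close>
  then have "\<forall>\<^sub>F t in at_bot. (\<forall>w\<in>W. t < w) \<and> sgn (poly f t) = sgn (poly g (h t))"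
    using eventually_sgn_poly_at_bot[OF nz(1)] eventually_compose_filterlim[OF eventually_sgn_poly_at_bot[OF nz(2)] hbot]
    by eventually_elim (use deg lc in simp)
  then obtain a0 where a0: "\<And>w. w \<in> W \<Longrightarrow> a0 < w" "sgn (poly f a0) = sgn (poly g (h a0))"
    using eventually_happens'[OF trivial_limit_at_bot_linorder] by blast
  have "\<forall>\<^sub>F t in at_top. \<forall>w\<in>W. w < t"
    using fin(4) by (intro eventually_ball_finite) auto
  then have "\<forall>\<^sub>F t in at_top. (\<forall>w\<in>W. w < t) \<and> sgn (poly f t) = sgn (poly g (h t))"
    using eventually_sgn_poly_at_top[OF nz(1)] eventually_compose_filterlim[OF eventually_sgn_poly_at_top[OF nz(2)] htop]
    by eventually_elim (use deg lc in simp)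
  then obtain b0 where b0: "\<And>w. w \<in> W \<Longrightarrow> w < b0" "sgn (poly f b0) = sgn (poly g (h b0))"
    using eventually_happens'[OF trivial_limit_at_top_linorder] by blast
  define R where "R = insert a0 (insert b0 R0)"
  have R: "finite R" "a0 \<in> R" "b0 \<in> R" using fin by (auto simp: R_def)
  have Rsg: "sgn (poly f a) = sgn (poly g (h a))" if "a \<in> R" for a
    using that a0 b0 sf by (auto simp: R_def R0_def)
  have Rp: "t \<in> R" if "i \<in> I" "poly (p i) t = 0" for i t using that by (auto simp: R_def R0_def)
  have Rf: "t \<in> R" if "poly (pderiv f) t = 0" for t using that j Rp[of j t] by simp
  have Rq: "\<exists>a\<in>R. u = h a" if "i \<in> I" "poly (q i) u = 0" for i u
    using that sg[of i "hi u"] Rp[of i "hi u"] by (metis hhi sgn_0_0)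
  have Rg: "\<exists>a\<in>R. u = h a" if "poly (pderiv g) u = 0" for u using that j Rq[of j u] by simp
  have bnd: "a0 < z" "z < b0" if "poly f z = 0" for z
    using a0(1)[of z] b0(1)[of z] that by (auto simp: W_def Z_def)
  have bnd': "h a0 < u" "u < h b0" if "poly g u = 0" for u
    using a0(1)[of "hi u"] b0(1)[of "hi u"] that strict_monoD[OF h(1), of a0 "hi u"] strict_monoD[OF h(1), of "hi u" b0]
    by (auto simp: W_def Z'_def)
  \<comment> \<open>\<open>u\<close> lies among the points \<open>h a\<close> exactly as
    \<open>z\<close> lies among the points \<open>a\<close> of \<open>R\<close>.\<close>
  define rel where "rel z u \<longleftrightarrow> (\<forall>a\<in>R. sgn (z - a) = sgn (u - h a))" for z u
  have relD: "(z < a \<longleftrightarrow> u < h a) \<and> (z = a \<longleftrightarrow> u = h a) \<and> (a < z \<longleftrightarrow> h a < u)" if "rel z u" "a \<in> R" for z u a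
    using that unfolding rel_def by (intro less_iff_of_sgn_diff_eq) blast
  have fg: "\<exists>u. poly g u = 0 \<and> rel z u" if "poly f z = 0" for z
    unfolding rel_def
    by (rule root_transfer[OF R(1) h(1) Rf Rsg that R(2) _ R(3)]) (use bnd[OF that] in simp_all)
  \<comment> \<open>The same transfer with \<open>f\<close> and \<open>g\<close> exchanged and with
    the inverse of \<open>h\<close>.\<close>
  have gf: "\<exists>z. poly f z = 0 \<and> rel z u" if "poly g u = 0" for u
  proof -
    have "\<exists>z. poly f z = 0 \<and> (\<forall>b\<in>h ` R. sgn (u - b) = sgn (z - hi b))"
    proof (rule root_transfer[where f = g and g = f and h = hi and ?a0.0 = "h a0" and ?b0.0 = "h b0", OF _ hi _ _ that])
      show "sgn (poly g b) = sgn (poly f (hi b))" if b: "b \<in> h ` R" for b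
      proof -
        obtain a where "a \<in> R" "b = h a" using b by blast
        then show ?thesis using Rsg[of a] by simp
      qed
      show "b \<in> h ` R" if "poly (pderiv g) b = 0" for b
        using Rg[OF that] by blast
      show "finite (h ` R)" "h a0 \<in> h ` R" "h b0 \<in> h ` R" using R by blast+
      show "h a0 \<le> u" "u \<le> h b0" using bnd'[OF that] by simp_all
    qed
    then obtain z where "poly f z = 0" "\<forall>b\<in>h ` R. sgn (u - b) = sgn (z - hi b)" by blast
    then have "poly f z = 0 \<and> rel z u" unfolding rel_def by force
    then show ?thesis by blast
  qed
  \<comment> \<open>The finite matching \<open>k\<close> will send a root of \<open>f\<close> to a
    root of \<open>g\<close> in the same position; for other points the image under \<open>h\<close>
    serves. On \<open>R\<close> the relation \<open>rel\<close> forces \<open>k\<close> to agree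
    with \<open>h\<close>.\<close>
  have "\<forall>z\<in>R \<union> Z. \<exists>u. rel z u \<and> (poly f z = 0 \<longrightarrow> poly g u = 0)"
  proof
    fix z assume "z \<in> R \<union> Z"
    show "\<exists>u. rel z u \<and> (poly f z = 0 \<longrightarrow> poly g u = 0)"
    proof (cases "poly f z = 0")
      case True
      then show ?thesis using fg by blast
    next
      case False
      have "sgn (z - a) = sgn (h z - h a)" for a
        using strict_monoD[OF h(1), of a z] strict_monoD[OF h(1), of z a]
        by (cases a z rule: linorder_cases) simp_all
      then show ?thesis using False unfolding rel_def by blast
    qed
  qed
  from bchoice[OF this] obtain k where k0: "\<forall>z\<in>R \<union> Z. rel z (k z) \<and> (poly f z = 0 \<longrightarrow> poly g (k z) = 0)" ..
  have k: "rel z (k z)" if "z \<in> R \<union> Z" for z using k0 that by blast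
  have kZ: "poly g (k z) = 0" if "z \<in> Z" for z using k0 that unfolding Z_def by blast
  have kR: "k a = h a" if "a \<in> R" for a
    using relD[OF k, of a a] that by simp
  have "strict_mono_on (R \<union> Z) k"
  proof (rule strict_mono_onI)
    fix z1 z2 assume z: "z1 \<in> R \<union> Z" "z2 \<in> R \<union> Z" "z1 < z2"
    \<comment> \<open>Two roots of \<open>f\<close> are separated by a critical point, which belongs
      to \<open>R\<close>; monotonicity of \<open>k\<close> then follows by comparing both images
      with \<open>h a\<close>.\<close>
    have "\<exists>a\<in>R. z1 \<le> a \<and> a \<le> z2"
    proof (cases "z1 \<in> R \<or> z2 \<in> R")
      case True
      then show ?thesis using less_imp_le[OF z(3)] by blast
    next
      case False
      then have "poly f z1 = poly f z2" using z by (auto simp: Z_def)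
      then show ?thesis using poly_rolle[OF z(3)] Rf by (meson less_imp_le)
    qed
    then obtain a where a: "a \<in> R" "z1 \<le> a" "a \<le> z2" by blast
    show "k z1 < k z2"
      using relD[OF k[OF z(1)] a(1)] relD[OF k[OF z(2)] a(1)] a z by linarith
  qed
  then obtain H where H: "strict_mono H" "surj H" "\<And>a. a \<in> R \<union> Z \<Longrightarrow> H a = k a"
    using strict_mono_extend[of "R \<union> Z" k] R fin by auto
  have HR: "H a = h a" if "a \<in> R" for a using that H kR by simp
  have Hg: "\<exists>z. poly f z = 0 \<and> H z = u" if u: "poly g u = 0" for u
  proof -
    from gf[OF u] obtain z where z: "poly f z = 0" "rel z u" by blast
    then have zZ: "z \<in> Z" by (simp add: Z_def)
    have kz: "poly g (k z) = 0" "rel z (k z)" using k kZ zZ by blast+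
    have "k z = u"
    \<comment> \<open>Two distinct roots of \<open>g\<close> would enclose a critical point
      \<open>h a\<close> of \<open>g\<close> by Rolle, yet both lie on the same side of every
      \<open>h a\<close>.\<close>
    proof (rule ccontr)
      assume "k z \<noteq> u"
      then have "\<exists>c. min (k z) u < c \<and> c < max (k z) u \<and> poly (pderiv g) c = 0"
        using poly_rolle[of "min (k z) u" "max (k z) u" g] u kz by (auto simp: min_def max_def)
      then obtain c where c: "min (k z) u < c" "c < max (k z) u" "poly (pderiv g) c = 0" by blast
      obtain a where a: "a \<in> R" "c = h a" using Rg[OF c(3)] by blast
      show False
        using relD[OF kz(2) a(1)] relD[OF z(2) a(1)] a(2) c by linarith
    qed
    then show ?thesis using z zZ H by auto
  qed
  have "sgn (poly (p i) t) = sgn (poly (q i) (H t))" if i: "i \<in> I" for i t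
  proof (cases "t \<in> R")
    case True
    then show ?thesis using sg[OF i] HR by simp
  next
    case False
    \<comment> \<open>Every root of \<open>q i\<close> is a common value of \<open>h\<close> and
      \<open>H\<close> at some point of \<open>R\<close>, so by monotonicity \<open>h t\<close> and
      \<open>H t\<close> lie on the same side of it.\<close>
    have "sgn (poly (q i) (h t)) = sgn (poly (q i) (H t))"
    proof (rule sgn_poly_eq_if_no_root, rule notI)
      fix u assume u: "u \<in> closed_segment (h t) (H t)" "poly (q i) u = 0"
      obtain a where a: "a \<in> R" "u = h a" using Rq[OF i u(2)] by blast
      then have "u = H a" using HR by simp
      moreover have "a < t \<or> t < a" using a False by (metis linorder_neqE_linordered_idom)
      ultimately show False
        using u a strict_monoD[OF h(1), of a t] strict_monoD[OF h(1), of t a] strict_monoD[OF H(1), of a t] strict_monoD[OF H(1), of t a]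
        by (cases "h t \<le> H t") (simp_all add: closed_segment_eq_real_ivl, linarith+)
    qed
    then show ?thesis using sg[OF i] by simp
  qed
  moreover have "sgn (poly f t) = sgn (poly g (H t))" for t
  proof (cases "poly f t = 0")
    case True
    then show ?thesis using kZ[of t] H(3)[of t] by (simp add: Z_def)
  next
    case False
    \<comment> \<open>A non-root \<open>t\<close> can be joined to a sample point without meeting a
      root of \<open>f\<close>: inside a gap, roots on both sides of \<open>t\<close> would give a
      critical point in the gap.\<close>
    have "\<exists>a\<in>R. \<forall>z\<in>closed_segment a t. poly f z \<noteq> 0"
    proof -
      consider "t < a0" | "b0 < t" | "t \<in> R" | "a0 \<le> t" "t \<le> b0" "t \<notin> R" by linarith
      then show ?thesis
      proof cases
        case 1
        then show ?thesis using bnd R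
          by (intro bexI[of _ a0]) (auto simp: closed_segment_eq_real_ivl, fastforce)
      next
        case 2
        then show ?thesis using bnd R
          by (intro bexI[of _ b0]) (auto simp: closed_segment_eq_real_ivl, fastforce)
      next
        case 3
        then show ?thesis using False by (intro bexI[of _ t]) auto
      next
        case 4
        obtain a b where ab: "a \<in> R" "b \<in> R" "a < t" "t < b" "\<And>c. c \<in> R \<Longrightarrow> c \<le> a \<or> b \<le> c"
          using finite_gap[OF R(1) R(2) R(3) 4] by metis
        show ?thesis
        proof (rule ccontr)
          assume *: "\<not> ?thesis"
          obtain z1 where "z1 \<in> closed_segment a t" "poly f z1 = 0" using * ab by blast
          then have z1: "a \<le> z1" "z1 \<le> t" "poly f z1 = 0" using ab by (simp_all add: closed_segment_eq_real_ivl)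
          obtain z2 where "z2 \<in> closed_segment b t" "poly f z2 = 0" using * ab by blast
          then have z2: "t \<le> z2" "z2 \<le> b" "poly f z2 = 0" using ab by (simp_all add: closed_segment_eq_real_ivl)
          have "z1 \<noteq> t" using z1 False by auto
          then obtain c where "z1 < c" "c < z2" "poly (pderiv f) c = 0"
            using poly_rolle[of z1 z2 f] z1 z2 by auto
          then show False using Rf[of c] ab(5)[of c] z1 z2 by linarith
        qed
      qed
    qed
    then obtain a where a: "a \<in> R" "\<And>z. z \<in> closed_segment a t \<Longrightarrow> poly f z \<noteq> 0" by blast
    have "sgn (poly g (H a)) = sgn (poly g (H t))"
    proof (rule sgn_poly_eq_if_no_root, rule notI)
      fix u assume u: "u \<in> closed_segment (H a) (H t)" "poly g u = 0"
      obtain z where z: "poly f z = 0" "H z = u" using Hg[OF u(2)] by blast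
      have "z \<in> closed_segment a t"
        using u z strict_mono_less_eq[OF H(1)]
        by (auto simp: closed_segment_eq_real_ivl split: if_splits)
      then show False using a z by blast
    qed
    moreover have "sgn (poly f a) = sgn (poly f t)"
      using a by (intro sgn_poly_eq_if_no_root) blast
    ultimately show ?thesis using Rsg[OF a(1)] HR[OF a(1)] by simp
  qed
  ultimately show ?thesis using H by blast
qed

section \<open>Closed families of polynomials with parameters\<close>

text \<open>This is the pseudo-remainder with respect to a formal degree \<open>n\<close> of
  \<open>g\<close>. Multiplying \<open>f\<close> by \<open>coeff g n\<close> replaces division, so
  the coefficients stay in the ring; step \<open>Suc k\<close> removes the coefficient at
  \<open>n + k\<close>.\<close>

primrec formal_prem :: "nat \<Rightarrow> nat \<Rightarrow> 'a::comm_ring_1 poly \<Rightarrow> 'a poly \<Rightarrow> 'a poly" where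
  "formal_prem 0 n f g = f"
| "formal_prem (Suc k) n f g =
     formal_prem k n (smult (coeff g n) f - monom (coeff f (n + k)) k * g) g"

lemma degree_formal_prem:
  assumes "0 < n" "degree g \<le> n" "degree f < n + k"
  shows "degree (formal_prem k n f g) < n"
  using assms(3)
proof (induction k arbitrary: f)
  case (Suc k)
  let ?f = "smult (coeff g n) f - monom (coeff f (n + k)) k * g"
  have "coeff ?f i = 0" if "i > n + k - 1" for i
  proof (cases "i = n + k")
    case True
    then show ?thesis by (simp add: coeff_monom_mult mult.commute[of "coeff f _"])
  next
    case False
    then have "coeff f i = 0" "coeff g (i - k) = 0"
      using that Suc.prems assms(1,2) by (auto intro!: coeff_eq_0)
    then show ?thesis using that by (simp add: coeff_monom_mult)
  qed
  then have "degree ?f \<le> n + k - 1"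
    by (intro degree_le) blast
  then show ?case
    using Suc.IH[of ?f] assms(1) by simp
qed simp

text \<open>All subtracted multiples of \<open>g\<close> vanish at \<open>t\<close>. Thus the sign
  of \<open>f\<close> at a root of \<open>g\<close> can be read off from a polynomial of lower
  degree, provided \<open>coeff g n\<close> is nonzero.\<close>

lemma poly_formal_prem_root:
  assumes "poly g t = 0"
  shows "poly (formal_prem k n f g) t = coeff g n ^ k * poly f t"
  by (induction k arbitrary: f) (simp_all add: assms)

text \<open>New elements appear in strictly decreasing degree, so a finite set has a finite closure.\<close>

lemma finite_closure_if_degree_decreasing:
  fixes op :: "'a \<Rightarrow> 'a \<Rightarrow> 'a set" and deg :: "'a \<Rightarrow> nat"
  assumes fin: "\<And>f g. finite (op f g)"
    and dec: "\<And>f g c. c \<in> op f g \<Longrightarrow> deg c < deg f \<and> deg c < deg g"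
    and I: "\<And>f g c. I f \<Longrightarrow> I g \<Longrightarrow> c \<in> op f g \<Longrightarrow> I c"
    and S: "finite S" "\<And>f. f \<in> S \<Longrightarrow> I f"
  shows "\<exists>T. S \<subseteq> T \<and> finite T \<and> (\<forall>f\<in>T. I f) \<and> (\<forall>f\<in>T. \<forall>g\<in>T. op f g \<subseteq> T)"
proof -
  obtain N where N: "\<And>f. f \<in> S \<Longrightarrow> deg f \<le> N"
    using finite_nat_set_iff_bounded_le[of "deg ` S"] S(1) by auto
  \<comment> \<open>After \<open>k\<close> rounds the set contains all results of degree at least
    \<open>N - k\<close>; at \<open>k = N\<close> this covers every result.\<close>
  have "\<exists>T. S \<subseteq> T \<and> finite T \<and> (\<forall>f\<in>T. I f) \<and> (\<forall>f\<in>T. \<forall>g\<in>T. \<forall>c\<in>op f g. N \<le> deg c + k \<longrightarrow> c \<in> T)" for k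
  proof (induction k)
    case 0
    have "\<not> N \<le> deg c" if "f \<in> S" "c \<in> op f g" for f g c
      using N[OF that(1)] dec[OF that(2)] by linarith
    then show ?case using S by (intro exI[of _ S]) auto
  next
    case (Suc k)
    then obtain T where T: "S \<subseteq> T" "finite T" "\<forall>f\<in>T. I f"
      "\<And>f g c. f \<in> T \<Longrightarrow> g \<in> T \<Longrightarrow> c \<in> op f g \<Longrightarrow> N \<le> deg c + k \<Longrightarrow> c \<in> T" by blast
    define T' where "T' = T \<union> (\<Union>f\<in>T. \<Union>g\<in>T. op f g)"
    have new: "deg f + k < N" if "f \<in> T'" "f \<notin> T" for f
    proof -
      from that obtain f1 f2 where "f1 \<in> T" "f2 \<in> T" "f \<in> op f1 f2" by (auto simp: T'_def)
      from T(4)[OF this] that(2) show ?thesis by (meson not_le)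
    qed
    have "c \<in> T'" if "f \<in> T'" "g \<in> T'" "c \<in> op f g" "N \<le> deg c + Suc k" for f g c
    proof -
      \<comment> \<open>The arguments have larger degree than \<open>c\<close>, hence too large a
        degree to be among the elements added in this round.\<close>
      have "f \<in> T" "g \<in> T" using new[OF that(1)] new[OF that(2)] dec[OF that(3)] that(4) by linarith+
      then show ?thesis using that(3) unfolding T'_def by blast
    qed
    moreover have "S \<subseteq> T'" "finite T'"
      using T(1,2) fin unfolding T'_def by auto
    moreover have "\<forall>f\<in>T'. I f"
      using T(3) I unfolding T'_def by blast
    ultimately show ?case by blast
  qed
  from this[of N] obtain T where T: "S \<subseteq> T" "finite T" "\<forall>f\<in>T. I f"
    "\<forall>f\<in>T. \<forall>g\<in>T. \<forall>c\<in>op f g. N \<le> deg c + N \<longrightarrow> c \<in> T" by blast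
  have "op f g \<subseteq> T" if "f \<in> T" "g \<in> T" for f g
  proof
    fix c assume "c \<in> op f g"
    then show "c \<in> T" using T(4)[rule_format, OF that] by simp
  qed
  then show ?thesis using T(1-3) by (intro exI[of _ T]) simp
qed

section \<open>Rings of coefficient functions and polynomials over them\<close>

locale real_fun_ring =
  fixes A :: "('x \<Rightarrow> real) set"
  assumes const: "(\<lambda>_. c) \<in> A"
    and add: "a \<in> A \<Longrightarrow> b \<in> A \<Longrightarrow> (\<lambda>x. a x + b x) \<in> A"
    and mult: "a \<in> A \<Longrightarrow> b \<in> A \<Longrightarrow> (\<lambda>x. a x * b x) \<in> A"
begin

lemma diff: "a \<in> A \<Longrightarrow> b \<in> A \<Longrightarrow> (\<lambda>x. a x - b x) \<in> A"
  using add[of a "\<lambda>x. -1 * b x"] mult[OF const, of b "-1"] by simp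

lemma sum: "(\<And>i. i \<in> J \<Longrightarrow> a i \<in> A) \<Longrightarrow> (\<lambda>x. \<Sum>i\<in>J. a i x) \<in> A"
  by (induction J rule: infinite_finite_induct) (auto intro: const add)

lemma prod: "(\<And>i. i \<in> J \<Longrightarrow> a i \<in> A) \<Longrightarrow> (\<lambda>x. \<Prod>i\<in>J. a i x) \<in> A"
  by (induction J rule: infinite_finite_induct) (auto intro: const mult)

lemma power: "a \<in> A \<Longrightarrow> (\<lambda>x. a x ^ k) \<in> A"
  by (induction k) (auto intro: const mult)

text \<open>A polynomial over the ring \<open>A\<close>, specialised at each parameter. The actual
  degree may drop at special parameters, which is why a formal degree is carried separately.\<close>

definition poly_fam :: "('x \<Rightarrow> real poly) \<Rightarrow> bool" where
  "poly_fam P \<longleftrightarrow> (\<forall>i. (\<lambda>x. coeff (P x) i) \<in> A)"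

lemma poly_fam_monom: "a \<in> A \<Longrightarrow> poly_fam (\<lambda>x. monom (a x) n)"
  unfolding poly_fam_def coeff_monom
proof
  show "(\<lambda>x. if n = i then a x else 0) \<in> A" if "a \<in> A" for i
    using that const by (cases "n = i") simp_all
qed

lemma poly_fam_add: "poly_fam P \<Longrightarrow> poly_fam Q \<Longrightarrow> poly_fam (\<lambda>x. P x + Q x)"
  unfolding poly_fam_def coeff_add using add by blast

lemma poly_fam_diff: "poly_fam P \<Longrightarrow> poly_fam Q \<Longrightarrow> poly_fam (\<lambda>x. P x - Q x)"
  unfolding poly_fam_def coeff_diff using diff by blast

lemma poly_fam_mult: "poly_fam P \<Longrightarrow> poly_fam Q \<Longrightarrow> poly_fam (\<lambda>x. P x * Q x)"
  by (auto simp: poly_fam_def coeff_mult intro!: sum mult)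

lemma poly_fam_smult: "a \<in> A \<Longrightarrow> poly_fam Q \<Longrightarrow> poly_fam (\<lambda>x. smult (a x) (Q x))"
  by (auto simp: poly_fam_def intro!: mult)

lemma poly_fam_pderiv: "poly_fam P \<Longrightarrow> poly_fam (\<lambda>x. pderiv (P x))"
  by (auto simp: poly_fam_def coeff_pderiv intro!: mult const)

lemma poly_fam_formal_prem:
  "poly_fam P \<Longrightarrow> poly_fam Q \<Longrightarrow> poly_fam (\<lambda>x. formal_prem k n (P x) (Q x))"
proof (induction k arbitrary: P)
  case (Suc k)
  have "(\<lambda>x. coeff (P x) i) \<in> A" "(\<lambda>x. coeff (Q x) i) \<in> A" for i
    using Suc.prems by (auto simp: poly_fam_def)
  then have "poly_fam (\<lambda>x. smult (coeff (Q x) n) (P x) - monom (coeff (P x) (n + k)) k * Q x)"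
    by (intro poly_fam_diff poly_fam_smult poly_fam_mult poly_fam_monom Suc.prems)
  from Suc.IH[OF this Suc.prems(2)] show ?case by simp
qed simp

end

text \<open>A pair \<open>(d, P)\<close> is a polynomial with parameters, of formal degree \<open>d\<close>.\<close>

definition formal_ops :: "nat \<times> ('x \<Rightarrow> real poly) \<Rightarrow> nat \<times> ('x \<Rightarrow> real poly) \<Rightarrow> (nat \<times> ('x \<Rightarrow> real poly)) set" where
  "formal_ops F G =
    (if 0 < fst G \<and> fst G \<le> fst F then
      {(fst G - 1, \<lambda>x. pderiv (snd G x)),
       (fst G - 1, \<lambda>x. snd G x - monom (coeff (snd G x) (fst G)) (fst G)),
       (fst G - 1, \<lambda>x. formal_prem (Suc (fst F) - fst G) (fst G) (snd F x) (snd G x))}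
     else {})"

text \<open>Every result has formal degree \<open>fst G - 1\<close>, which the guard
  \<open>fst G \<le> fst F\<close> makes smaller than that of both arguments. The invariant kept is
  that coefficients lie in \<open>A\<close> and that formal degrees bound the actual ones.\<close>

lemma (in real_fun_ring) formal_ops_closure:
  assumes "finite S" "\<And>F. F \<in> S \<Longrightarrow> poly_fam (snd F) \<and> (\<forall>x. degree (snd F x) \<le> fst F)"
  shows "\<exists>T. S \<subseteq> T \<and> finite T \<and> (\<forall>F\<in>T. poly_fam (snd F) \<and> (\<forall>x. degree (snd F x) \<le> fst F))
    \<and> (\<forall>F\<in>T. \<forall>G\<in>T. formal_ops F G \<subseteq> T)"
proof (rule finite_closure_if_degree_decreasing[where deg = fst, OF _ _ _ assms(1)])
  show "poly_fam (snd F) \<and> (\<forall>x. degree (snd F x) \<le> fst F)" if "F \<in> S" for F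
    using assms(2)[OF that] .
next
  fix F G H :: "nat \<times> ('x \<Rightarrow> real poly)"
  assume F: "poly_fam (snd F) \<and> (\<forall>x. degree (snd F x) \<le> fst F)"
    and G: "poly_fam (snd G) \<and> (\<forall>x. degree (snd G x) \<le> fst G)"
    and H: "H \<in> formal_ops F G"
  have n: "0 < fst G" "fst G \<le> fst F" using H by (auto simp: formal_ops_def split: if_splits)
  have cG: "(\<lambda>x. coeff (snd G x) (fst G)) \<in> A" using G by (auto simp: poly_fam_def)
  consider "H = (fst G - 1, \<lambda>x. pderiv (snd G x))"
    | "H = (fst G - 1, \<lambda>x. snd G x - monom (coeff (snd G x) (fst G)) (fst G))"
    | "H = (fst G - 1, \<lambda>x. formal_prem (Suc (fst F) - fst G) (fst G) (snd F x) (snd G x))"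
    using H n by (auto simp: formal_ops_def)
  then show "poly_fam (snd H) \<and> (\<forall>x. degree (snd H x) \<le> fst H)"
  proof cases
    case 1
    have "degree (pderiv (snd G x)) \<le> fst G - 1" for x
      using G by (simp add: degree_pderiv diff_le_mono)
    then show ?thesis using 1 G by (simp add: poly_fam_pderiv)
  next
    case 2
    have "degree (snd G x - monom (coeff (snd G x) (fst G)) (fst G)) \<le> fst G - 1" for x
    proof (rule degree_le, safe)
      fix i assume i: "fst G - 1 < i"
      show "coeff (snd G x - monom (coeff (snd G x) (fst G)) (fst G)) i = 0"
      proof (cases "i = fst G")
        case False
        then have "degree (snd G x) < i" using i n G[THEN conjunct2, rule_format, of x] by linarith
        then show ?thesis using False by (simp add: coeff_eq_0)
      qed simp
    qed
    then show ?thesis using 2 G cG by (simp add: poly_fam_diff poly_fam_monom)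
  next
    case 3
    have "degree (formal_prem (Suc (fst F) - fst G) (fst G) (snd F x) (snd G x)) < fst G" for x
    proof (rule degree_formal_prem)
      have "degree (snd F x) \<le> fst F" using F by blast
      then show "degree (snd F x) < fst G + (Suc (fst F) - fst G)" using n by linarith
    qed (use G n in simp_all)
    then have "degree (formal_prem (Suc (fst F) - fst G) (fst G) (snd F x) (snd G x)) \<le> fst G - 1" for x
      by (metis Suc_pred' n(1) less_Suc_eq_le)
    then show ?thesis using 3 F G by (simp add: poly_fam_formal_prem)
  qed
qed (auto simp: formal_ops_def split: if_splits)

text \<open>The members whose formal leading coefficient is nonzero at \<open>x\<close>, hence also
  at \<open>y\<close>, are added in order of formal degree by \<open>sign_iso_step\<close>.
  Derivatives provide the critical points, pseudo-remainders the signs at roots of earlier members,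
  and truncations handle members whose leading coefficient vanishes.\<close>

lemma sign_iso_of_closed_family:
  fixes T :: "(nat \<times> ('x \<Rightarrow> real poly)) set"
  assumes fin: "finite T"
    and deg: "\<And>F z. F \<in> T \<Longrightarrow> degree (snd F z) \<le> fst F"
    and closed: "\<And>F G. F \<in> T \<Longrightarrow> G \<in> T \<Longrightarrow> formal_ops F G \<subseteq> T"
    and sg: "\<And>F i. F \<in> T \<Longrightarrow> sgn (coeff (snd F x) i) = sgn (coeff (snd F y) i)"
  shows "\<exists>h. strict_mono h \<and> surj h \<and> (\<forall>F\<in>T. \<forall>t. sgn (poly (snd F x) t) = sgn (poly (snd F y) (h t)))"
proof -
  define L where "L = {F \<in> T. coeff (snd F x) (fst F) \<noteq> 0}"
  have finL: "finite L" using fin by (simp add: L_def)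
  \<comment> \<open>If the formal leading coefficient vanishes at \<open>x\<close>, it vanishes at
    \<open>y\<close> as well, so truncating changes neither specialisation and lowers the formal
    degree.\<close>
  have trunc: "F \<in> T \<Longrightarrow> (snd F x = 0 \<and> snd F y = 0) \<or>
      (\<exists>G\<in>L. fst G \<le> fst F \<and> snd G x = snd F x \<and> snd G y = snd F y)" for F
  proof (induction "fst F" arbitrary: F rule: less_induct)
    case less
    note F = \<open>F \<in> T\<close>
    consider "F \<in> L" | "coeff (snd F x) (fst F) = 0" "fst F = 0" | "coeff (snd F x) (fst F) = 0" "fst F > 0"
      using F unfolding L_def by (cases "fst F") auto
    then show ?case
    proof cases
      case 1
      then show ?thesis by blast
    next
      case 2
      have "coeff (snd F y) (fst F) = 0" using sg[OF F, of "fst F"] 2 by (simp add: sgn_0_0)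
      then show ?thesis using 2 deg[OF F, of x] deg[OF F, of y]
        by (metis le_zero_eq leading_coeff_0_iff)
    next
      case 3
      have y: "coeff (snd F y) (fst F) = 0" using sg[OF F, of "fst F"] 3 by (simp add: sgn_0_0)
      let ?G = "(fst F - 1, \<lambda>x. snd F x - monom (coeff (snd F x) (fst F)) (fst F))"
      have "?G \<in> T" using closed[OF F F] 3 by (auto simp: formal_ops_def)
      from less.hyps[OF _ this] show ?thesis using 3 y by fastforce
    qed
  qed
  \<comment> \<open>\<open>M\<close> is an initial piece of \<open>L\<close> with respect to formal
    degree, and the inserted element has maximal degree. So everything of smaller degree is already
    matched.\<close>
  have "M \<subseteq> L \<longrightarrow> (\<forall>F\<in>M. \<forall>G\<in>L. fst G < fst F \<longrightarrow> G \<in> M) \<longrightarrow>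
    (\<exists>h. strict_mono h \<and> surj h \<and> (\<forall>F\<in>M. \<forall>t. sgn (poly (snd F x) t) = sgn (poly (snd F y) (h t))))"
    if "finite M" for M
    using that
  proof (induction M rule: finite_ranking_induct[where f = fst])
    case empty
    have "strict_mono (id :: real \<Rightarrow> real) \<and> surj (id :: real \<Rightarrow> real)"
      by (simp add: strict_mono_def)
    then show ?case by blast
  next
    case (insert F M)
    show ?case
    proof (intro impI)
      assume sub: "insert F M \<subseteq> L" and down: "\<forall>F'\<in>insert F M. \<forall>G\<in>L. fst G < fst F' \<longrightarrow> G \<in> insert F M"
      have down': "G \<in> M" if "G \<in> L" "fst G < fst F" for G using that down by blast
      have "\<forall>F'\<in>M. \<forall>G\<in>L. fst G < fst F' \<longrightarrow> G \<in> M"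
        using insert.hyps(2) down' by (meson less_le_trans)
      then obtain h where h: "strict_mono h" "surj h"
        and hM: "\<And>G t. G \<in> M \<Longrightarrow> sgn (poly (snd G x) t) = sgn (poly (snd G y) (h t))"
        using insert.IH sub by blast
      define d where "d = fst F"
      have FT: "F \<in> T" and cx: "coeff (snd F x) d \<noteq> 0" using sub by (auto simp: L_def d_def)
      have cy: "coeff (snd F y) d \<noteq> 0" using sg[OF FT, of d] cx by (metis sgn_0_0)
      have dx: "degree (snd F x) = d" and dy: "degree (snd F y) = d"
        using deg[OF FT, folded d_def] le_degree[OF cx] le_degree[OF cy] by (simp_all add: le_antisym)
      show "\<exists>h. strict_mono h \<and> surj h \<and> (\<forall>F\<in>insert F M. \<forall>t. sgn (poly (snd F x) t) = sgn (poly (snd F y) (h t)))"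
      proof (cases "d = 0")
        case True
        then obtain a b where "snd F x = [:a:]" "snd F y = [:b:]"
          using dx dy by (metis degree_eq_zeroE)
        then have "sgn (poly (snd F x) t) = sgn (poly (snd F y) (h t))" for t
          using sg[OF FT, of 0] by simp
        then show ?thesis using h hM by blast
      next
        case False
        let ?F' = "(d - 1, \<lambda>x. pderiv (snd F x))"
        have "?F' \<in> T" using closed[OF FT FT] False by (auto simp: formal_ops_def d_def)
        then have "?F' \<in> L" using cx False by (auto simp: L_def coeff_pderiv)
        then have F'M: "?F' \<in> M" using False by (intro down') (auto simp: d_def)
        have step: "\<exists>H. strict_mono H \<and> surj H \<and> (\<forall>G\<in>M. \<forall>t. sgn (poly (snd G x) t) = sgn (poly (snd G y) (H t)))
          \<and> (\<forall>t. sgn (poly (snd F x) t) = sgn (poly (snd F y) (H t)))"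
        proof (rule sign_iso_step[OF insert.hyps(1) _ h hM _ F'M])
          show "snd G x \<noteq> 0" if "G \<in> M" for G using that sub by (auto simp: L_def)
          show "snd F x \<noteq> 0" "snd F y \<noteq> 0" using cx cy by auto
          show "degree (snd F x) = degree (snd F y)" using dx dy by simp
          show "sgn (lead_coeff (snd F x)) = sgn (lead_coeff (snd F y))" using dx dy sg[OF FT] by simp
          fix G t assume G: "G \<in> M" and t: "poly (snd G x) t = 0"
          have ty: "poly (snd G y) (h t) = 0" using hM[OF G, of t] t by (simp add: sgn_0_0)
          define n where "n = fst G"
          have GT: "G \<in> T" and gx: "coeff (snd G x) n \<noteq> 0" using G sub by (auto simp: L_def n_def)
          have nd: "n \<le> d" using insert.hyps(2)[OF G] by (simp add: n_def d_def)
          have "n \<noteq> 0"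
          proof
            assume "n = 0"
            then have "degree (snd G x) = 0" using deg[OF GT, of x] by (simp add: n_def)
            then obtain a where "snd G x = [:a:]" by (metis degree_eq_zeroE)
            then show False using t gx \<open>n = 0\<close> by simp
          qed
          \<comment> \<open>The pseudo-remainder has formal degree below \<open>d\<close>, so its
            truncation is zero or already in \<open>M\<close>, and its signs at \<open>t\<close> and
            \<open>h t\<close> agree. The common sign of the powers of
            \<open>coeff (snd G x) n\<close> and \<open>coeff (snd G y) n\<close> is then
            cancelled.\<close>
          define R where "R z = formal_prem (Suc d - n) n (snd F z) (snd G z)" for z
          have "(n - 1, R) \<in> T" using closed[OF FT GT] nd \<open>n \<noteq> 0\<close>
            by (auto simp: formal_ops_def d_def n_def R_def[abs_def])
          from trunc[OF this] have "sgn (poly (R x) t) = sgn (poly (R y) (h t))"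
          proof
            assume "\<exists>G\<in>L. fst G \<le> fst (n - 1, R) \<and> snd G x = snd (n - 1, R) x \<and> snd G y = snd (n - 1, R) y"
            then obtain G' where G': "G' \<in> L" "fst G' \<le> n - 1" "snd G' x = R x" "snd G' y = R y" by auto
            then have "G' \<in> M" using nd \<open>n \<noteq> 0\<close> by (intro down') (auto simp: d_def)
            then show ?thesis using hM[of G' t] G' by simp
          qed simp
          moreover have "sgn (coeff (snd G x) n) = sgn (coeff (snd G y) n)" using sg[OF GT] .
          moreover have "sgn (coeff (snd G x) n) \<noteq> 0" using gx by (simp add: sgn_0_0)
          ultimately show "sgn (poly (snd F x) t) = sgn (poly (snd F y) (h t))"
            unfolding R_def poly_formal_prem_root[OF t] poly_formal_prem_root[OF ty] sgn_mult power_sgn[symmetric]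
            by simp
        qed auto
        then show ?thesis by blast
      qed
    qed
  qed
  from this[OF finL] obtain h where h: "strict_mono h" "surj h"
    "\<And>F t. F \<in> L \<Longrightarrow> sgn (poly (snd F x) t) = sgn (poly (snd F y) (h t))" by blast
  have "sgn (poly (snd F x) t) = sgn (poly (snd F y) (h t))" if "F \<in> T" for F t
    using trunc[OF that] h(3) by (metis poly_0 )
  then show ?thesis using h by blast
qed

section \<open>Quantifier elimination\<close>

text \<open>For \<open>A\<close> a set of polynomial functions these are the semialgebraic sets: a
  finite \<open>B\<close> has finitely many sign vectors, so the set is a finite union of sign
  conditions. This form needs no syntax of formulas.\<close>

definition sign_definable :: "('x \<Rightarrow> real) set \<Rightarrow> 'x set \<Rightarrow> bool" where
  "sign_definable A S \<longleftrightarrow> (\<exists>B. finite B \<and> B \<subseteq> A \<and>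
     (\<forall>x y. (\<forall>b\<in>B. sgn (b x) = sgn (b y)) \<longrightarrow> (x \<in> S \<longleftrightarrow> y \<in> S)))"

lemma sign_definable_Int:
  assumes "sign_definable A S" "sign_definable A T"
  shows "sign_definable A (S \<inter> T)"
proof -
  obtain B where B: "finite B" "B \<subseteq> A" "\<And>x y. (\<forall>b\<in>B. sgn (b x) = sgn (b y)) \<Longrightarrow> x \<in> S \<longleftrightarrow> y \<in> S"
    using assms(1) unfolding sign_definable_def by metis
  obtain C where C: "finite C" "C \<subseteq> A" "\<And>x y. (\<forall>b\<in>C. sgn (b x) = sgn (b y)) \<Longrightarrow> x \<in> T \<longleftrightarrow> y \<in> T"
    using assms(2) unfolding sign_definable_def by metis
  have "x \<in> S \<inter> T \<longleftrightarrow> y \<in> S \<inter> T" if "\<forall>b\<in>B \<union> C. sgn (b x) = sgn (b y)" for x y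
    using B(3)[of x y] C(3)[of x y] that by blast
  moreover have "finite (B \<union> C)" "B \<union> C \<subseteq> A" using B C by auto
  ultimately show ?thesis unfolding sign_definable_def by blast
qed

lemma sign_definable_pos:
  assumes "a \<in> A"
  shows "sign_definable A {x. 0 < a x}"
proof -
  have "x \<in> {x. 0 < a x} \<longleftrightarrow> y \<in> {x. 0 < a x}" if "\<forall>b\<in>{a}. sgn (b x) = sgn (b y)" for x y
    using that sgn_greater[of "a x"] sgn_greater[of "a y"] by simp
  then show ?thesis
    unfolding sign_definable_def using assms by (intro exI[of _ "{a}"]) blast
qed

lemma sign_definable_nonneg:
  assumes "a \<in> A"
  shows "sign_definable A {x. 0 \<le> a x}"
proof -
  have "x \<in> {x. 0 \<le> a x} \<longleftrightarrow> y \<in> {x. 0 \<le> a x}" if "\<forall>b\<in>{a}. sgn (b x) = sgn (b y)" for x y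
    using that sgn_less[of "a x"] sgn_less[of "a y"] by (simp flip: not_less)
  then show ?thesis
    unfolding sign_definable_def using assms by (intro exI[of _ "{a}"]) blast
qed

text \<open>\<open>B\<close> consists of the coefficients, up to the formal degree, of a finite
  closed family containing the given polynomials; higher coefficients are zero everywhere.\<close>

lemma (in real_fun_ring) sign_iso_of_poly_fams:
  assumes fin: "finite \<P>" and fam: "\<And>P. P \<in> \<P> \<Longrightarrow> poly_fam P \<and> (\<exists>d. \<forall>x. degree (P x) \<le> d)"
  shows "\<exists>B. finite B \<and> B \<subseteq> A \<and> (\<forall>x y. (\<forall>b\<in>B. sgn (b x) = sgn (b y)) \<longrightarrow>
    (\<exists>h. strict_mono h \<and> surj h \<and> (\<forall>P\<in>\<P>. \<forall>t. sgn (poly (P x) t) = sgn (poly (P y) (h t)))))"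
proof -
  have "\<forall>P\<in>\<P>. \<exists>d. \<forall>x. degree (P x) \<le> d" using fam by blast
  from bchoice[OF this] obtain d where d: "\<forall>P\<in>\<P>. \<forall>x. degree (P x) \<le> d P" ..
  define S where "S = (\<lambda>P. (d P, P)) ` \<P>"
  have "\<exists>T. S \<subseteq> T \<and> finite T \<and> (\<forall>F\<in>T. poly_fam (snd F) \<and> (\<forall>x. degree (snd F x) \<le> fst F))
    \<and> (\<forall>F\<in>T. \<forall>G\<in>T. formal_ops F G \<subseteq> T)"
    by (rule formal_ops_closure) (use fin fam d in \<open>auto simp: S_def\<close>)
  then obtain T where T: "S \<subseteq> T" "finite T" "\<And>F. F \<in> T \<Longrightarrow> poly_fam (snd F)"
    "\<And>F x. F \<in> T \<Longrightarrow> degree (snd F x) \<le> fst F" "\<And>F G. F \<in> T \<Longrightarrow> G \<in> T \<Longrightarrow> formal_ops F G \<subseteq> T" by blast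
  define B where "B = (\<Union>F\<in>T. (\<lambda>i x. coeff (snd F x) i) ` {..fst F})"
  have "finite B" using T(2) by (auto simp: B_def)
  moreover have "B \<subseteq> A" using T(3) by (auto simp: B_def poly_fam_def)
  moreover have "\<exists>h. strict_mono h \<and> surj h \<and> (\<forall>P\<in>\<P>. \<forall>t. sgn (poly (P x) t) = sgn (poly (P y) (h t)))"
    if xy: "\<forall>b\<in>B. sgn (b x) = sgn (b y)" for x y
  proof -
    have cf: "sgn (coeff (snd F x) i) = sgn (coeff (snd F y) i)" if F: "F \<in> T" for F i
    proof (cases "i \<le> fst F")
      case True
      then have "(\<lambda>x. coeff (snd F x) i) \<in> B" using F by (auto simp: B_def)
      from bspec[OF xy this] show ?thesis .
    next
      case False
      then have "degree (snd F z) < i" for z using T(4)[OF F, of z] by linarith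
      then show ?thesis by (simp add: coeff_eq_0)
    qed
    obtain h where h: "strict_mono h" "surj h" "\<forall>F\<in>T. \<forall>t. sgn (poly (snd F x) t) = sgn (poly (snd F y) (h t))"
      using sign_iso_of_closed_family[OF T(2) T(4) T(5) cf] by blast
    have "sgn (poly (P x) t) = sgn (poly (P y) (h t))" if "P \<in> \<P>" for P t
    proof -
      have "(d P, P) \<in> T" using T(1) that by (auto simp: S_def)
      from h(3)[rule_format, OF this] show ?thesis by simp
    qed
    then show ?thesis using h by blast
  qed
  ultimately show ?thesis by blast
qed

section \<open>Polynomial functions and elimination of variables\<close>

text \<open>All functions live on full environments and \<open>V\<close> records which variables may
  occur, so eliminating a variable shrinks \<open>V\<close> without a change of type.\<close>

inductive_set polyfuns :: "'v set \<Rightarrow> (('v \<Rightarrow> real) \<Rightarrow> real) set" for V where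
  const: "(\<lambda>_. c) \<in> polyfuns V"
| var: "v \<in> V \<Longrightarrow> (\<lambda>e. e v) \<in> polyfuns V"
| add: "a \<in> polyfuns V \<Longrightarrow> b \<in> polyfuns V \<Longrightarrow> (\<lambda>e. a e + b e) \<in> polyfuns V"
| mult: "a \<in> polyfuns V \<Longrightarrow> b \<in> polyfuns V \<Longrightarrow> (\<lambda>e. a e * b e) \<in> polyfuns V"

interpretation pf: real_fun_ring "polyfuns V" for V
  by unfold_locales (fact polyfuns.const polyfuns.add polyfuns.mult)+

text \<open>A polynomial in several variables is a polynomial in \<open>v\<close> with coefficients
  in the others. The uniform bound \<open>d\<close> will be its formal degree.\<close>

lemma polyfuns_as_poly_fam:
  assumes "a \<in> polyfuns V"
  shows "\<exists>P. pf.poly_fam (V - {v}) P \<and> (\<exists>d. \<forall>e. degree (P e) \<le> d) \<and> (\<forall>e t. a (e(v := t)) = poly (P e) t)"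
  using assms
proof (induction rule: polyfuns.induct)
  case (const c)
  have "pf.poly_fam (V - {v}) (\<lambda>_. monom c 0)" by (intro pf.poly_fam_monom polyfuns.const)
  then show ?case by (intro exI[of _ "\<lambda>_. monom c 0"]) (auto simp: poly_monom degree_monom_eq monom_0)
next
  case (var w)
  show ?case
  proof (cases "w = v")
    case True
    have "pf.poly_fam (V - {v}) (\<lambda>_. monom 1 1)" by (intro pf.poly_fam_monom polyfuns.const)
    then show ?thesis using True
      by (intro exI[of _ "\<lambda>_. monom 1 1"]) (auto simp: poly_monom degree_monom_eq)
  next
    case False
    then have "pf.poly_fam (V - {v}) (\<lambda>e. monom (e w) 0)"
      using var by (intro pf.poly_fam_monom polyfuns.var) auto
    then show ?thesis using False
      by (intro exI[of _ "\<lambda>e. monom (e w) 0"]) (auto simp: monom_0)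
  qed
next
  case (add a b)
  then obtain P d Q d' where "pf.poly_fam (V - {v}) P" "\<forall>e. degree (P e) \<le> d" "\<forall>e t. a (e(v := t)) = poly (P e) t"
    "pf.poly_fam (V - {v}) Q" "\<forall>e. degree (Q e) \<le> d'" "\<forall>e t. b (e(v := t)) = poly (Q e) t" by blast
  moreover from this have "\<forall>e. degree (P e + Q e) \<le> max d d'"
    by (simp add: degree_add_le max.coboundedI1 max.coboundedI2)
  ultimately show ?case
    by (intro exI[of _ "\<lambda>e. P e + Q e"] conjI pf.poly_fam_add) (auto simp del: fun_upd_apply)
next
  case (mult a b)
  then obtain P d Q d' where "pf.poly_fam (V - {v}) P" "\<forall>e. degree (P e) \<le> d" "\<forall>e t. a (e(v := t)) = poly (P e) t"
    "pf.poly_fam (V - {v}) Q" "\<forall>e. degree (Q e) \<le> d'" "\<forall>e t. b (e(v := t)) = poly (Q e) t" by blast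
  moreover from this have "\<forall>e. degree (P e * Q e) \<le> d + d'"
    by (meson add_mono degree_mult_le order_trans)
  ultimately show ?case
    by (intro exI[of _ "\<lambda>e. P e * Q e"] conjI pf.poly_fam_mult) (auto simp del: fun_upd_apply)
qed

text \<open>When the coefficient signs at \<open>x\<close> and \<open>y\<close> agree, the bijection
  \<open>h\<close> matches all signs along the two lines in direction \<open>v\<close>; it carries a
  witness \<open>t\<close> for \<open>x\<close> to the witness \<open>h t\<close> for
  \<open>y\<close>.\<close>

lemma sign_definable_projection:
  assumes "sign_definable (polyfuns V) S"
  shows "sign_definable (polyfuns (V - {v})) {e. \<exists>t. e(v := t) \<in> S}"
proof -
  obtain B where B: "finite B" "B \<subseteq> polyfuns V" "\<And>x y. (\<forall>b\<in>B. sgn (b x) = sgn (b y)) \<Longrightarrow> x \<in> S \<longleftrightarrow> y \<in> S"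
    using assms unfolding sign_definable_def by metis
  have "\<forall>b\<in>B. \<exists>P. pf.poly_fam (V - {v}) P \<and> (\<exists>d. \<forall>e. degree (P e) \<le> d) \<and> (\<forall>e t. b (e(v := t)) = poly (P e) t)"
    by (intro ballI polyfuns_as_poly_fam subsetD[OF B(2)])
  from bchoice[OF this] obtain P where P: "\<forall>b\<in>B. pf.poly_fam (V - {v}) (P b) \<and>
    (\<exists>d. \<forall>e. degree (P b e) \<le> d) \<and> (\<forall>e t. b (e(v := t)) = poly (P b e) t)" ..
  have "\<exists>C. finite C \<and> C \<subseteq> polyfuns (V - {v}) \<and> (\<forall>x y. (\<forall>b\<in>C. sgn (b x) = sgn (b y)) \<longrightarrow>
    (\<exists>h. strict_mono h \<and> surj h \<and> (\<forall>p\<in>P ` B. \<forall>t. sgn (poly (p x) t) = sgn (poly (p y) (h t)))))"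
    by (rule pf.sign_iso_of_poly_fams) (use B(1) P in blast)+
  then obtain C where C: "finite C" "C \<subseteq> polyfuns (V - {v})" "\<And>x y. \<forall>b\<in>C. sgn (b x) = sgn (b y) \<Longrightarrow>
    \<exists>h. strict_mono h \<and> surj h \<and> (\<forall>p\<in>P ` B. \<forall>t. sgn (poly (p x) t) = sgn (poly (p y) (h t)))"
    by blast
  have *: "\<exists>t. y(v := t) \<in> S" if xy: "\<forall>b\<in>C. sgn (b x) = sgn (b y)" and t: "x(v := t) \<in> S" for x y t
  proof -
    obtain h where h: "\<forall>p\<in>P ` B. \<forall>t. sgn (poly (p x) t) = sgn (poly (p y) (h t))"
      using C(3)[OF xy] by blast
    have "sgn (b (x(v := t))) = sgn (b (y(v := h t)))" if "b \<in> B" for b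
      using h P that by (simp del: fun_upd_apply)
    then have "y(v := h t) \<in> S" using B(3)[of "x(v := t)" "y(v := h t)"] t by blast
    then show ?thesis by blast
  qed
  have "x \<in> {e. \<exists>t. e(v := t) \<in> S} \<longleftrightarrow> y \<in> {e. \<exists>t. e(v := t) \<in> S}"
    if "\<forall>b\<in>C. sgn (b x) = sgn (b y)" for x y
  proof -
    have "\<forall>b\<in>C. sgn (b y) = sgn (b x)" using that by simp
    then show ?thesis using *[OF that] *[of y x] by blast
  qed
  then show ?thesis using C(1,2) unfolding sign_definable_def by blast
qed

lemma sign_definable_projection_finite:
  assumes "finite W" "sign_definable (polyfuns V) S"
  shows "sign_definable (polyfuns (V - W)) {e. \<exists>e'\<in>S. \<forall>v. v \<notin> W \<longrightarrow> e' v = e v}"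
  using assms(1)
proof (induction W rule: finite_induct)
  case empty
  have "{e. \<exists>e'\<in>S. \<forall>v. v \<notin> {} \<longrightarrow> e' v = e v} = S" by (auto simp flip: fun_eq_iff)
  then show ?case using assms(2) by simp
next
  case (insert w W)
  have "{e. \<exists>e'\<in>S. \<forall>v. v \<notin> insert w W \<longrightarrow> e' v = e v} =
    {e. \<exists>t. e(w := t) \<in> {e. \<exists>e'\<in>S. \<forall>v. v \<notin> W \<longrightarrow> e' v = e v}}" (is "?L = ?R")
  proof
    show "?L \<subseteq> ?R"
    proof
      fix e assume "e \<in> ?L"
      then obtain e' where e': "e' \<in> S" "\<forall>v. v \<notin> insert w W \<longrightarrow> e' v = e v" by blast
      then have "\<forall>v. v \<notin> W \<longrightarrow> e' v = (e(w := e' w)) v" by simp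
      with e'(1) show "e \<in> ?R" by blast
    qed
    show "?R \<subseteq> ?L" by (auto split: if_splits)
  qed
  moreover have "V - insert w W = V - W - {w}" by auto
  ultimately show ?case using sign_definable_projection[OF insert.IH, of w] by simp
qed

section \<open>Growth of semialgebraic functions\<close>

text \<open>The outer variable is \<open>t\<close> and the coefficients are polynomials in
  \<open>s\<close>, so the constant coefficient of \<open>Q\<close> is its restriction to
  \<open>t = 0\<close>.\<close>

abbreviation poly2 :: "real poly poly \<Rightarrow> real \<Rightarrow> real \<Rightarrow> real" where
  "poly2 Q t s \<equiv> poly (poly Q [:t:]) s"

lemma polyfuns_pair:
  assumes "a \<in> polyfuns V" "V \<subseteq> {v, w}"
  shows "\<exists>Q. \<forall>e. a e = poly2 Q (e v) (e w)"
  using assms(1)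
proof (induction rule: polyfuns.induct)
  case (const c)
  show ?case by (rule exI[of _ "[:[:c:]:]"]) simp
next
  case (var u)
  then consider "u = v" | "u = w" using assms(2) by blast
  then show ?case
  proof cases
    case 1
    then show ?thesis by (intro exI[of _ "[:0, 1:]"]) simp
  next
    case 2
    then show ?thesis by (intro exI[of _ "[:[:0, 1:]:]"]) simp
  qed
next
  case (add a b)
  then obtain P Q where "\<forall>e. a e = poly2 P (e v) (e w)" "\<forall>e. b e = poly2 Q (e v) (e w)" by blast
  then show ?case by (intro exI[of _ "P + Q"]) simp
next
  case (mult a b)
  then obtain P Q where "\<forall>e. a e = poly2 P (e v) (e w)" "\<forall>e. b e = poly2 Q (e v) (e w)" by blast
  then show ?case by (intro exI[of _ "P * Q"]) simp
qed

lemma continuous_on_poly2: "continuous_on UNIV (\<lambda>z. poly2 Q (fst z) (snd z))"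
  by (induction Q) (auto intro!: continuous_intros)

text \<open>After dividing by powers of \<open>t\<close>, the equation reads \<open>s\<^sup>k u(s) = - t R(t, s)\<close> with \<open>u(0) \<noteq> 0\<close>.\<close>

lemma poly2_zero_growth:
  fixes Q :: "real poly poly"
  assumes "Q \<noteq> 0"
  shows "\<exists>m\<ge>2. \<exists>K>0. \<exists>\<eta>>0. \<forall>t s. 0 < t \<and> t < \<eta> \<and> 0 < s \<and> s < \<eta> \<and> poly2 Q t s = 0 \<longrightarrow> s ^ m \<le> K * t"
proof -
  obtain i Q' where Q': "Q = [:- 0, 1:] ^ i * Q'" "\<not> [:- 0, 1:] dvd Q'"
    using order_decomp[OF assms, of 0] by blast
  \<comment> \<open>With all factors \<open>t\<close> removed, the restriction \<open>c\<close> to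
    \<open>t = 0\<close> is a nonzero polynomial in \<open>s\<close>; splitting off its factors
    \<open>s\<close> gives \<open>u\<close>.\<close>
  obtain c R where cR: "Q' = pCons c R" by (cases Q')
  have "c \<noteq> 0" using Q'(2) unfolding dvd_iff_poly_eq_0 cR by simp
  then obtain k u where u: "c = [:- 0, 1:] ^ k * u" "\<not> [:- 0, 1:] dvd u"
    using order_decomp[of c 0] by blast
  have u0: "poly u 0 \<noteq> 0" using u(2) unfolding dvd_iff_poly_eq_0 by simp
  define b where "b = \<bar>poly u 0\<bar> / 2"
  have b: "b > 0" using u0 by (simp add: b_def)
  have "isCont (\<lambda>s. \<bar>poly u s\<bar>) 0" by (intro continuous_intros)
  then have "(\<lambda>s. \<bar>poly u s\<bar>) \<midarrow>0\<rightarrow> \<bar>poly u 0\<bar>" by (simp add: isCont_def)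
  then have "\<forall>\<^sub>F s in at 0. b < \<bar>poly u s\<bar>" by (rule order_tendstoD) (use b in \<open>simp add: b_def\<close>)
  then obtain \<eta>1 where \<eta>1: "\<eta>1 > 0" "\<And>s. s \<noteq> 0 \<Longrightarrow> \<bar>s\<bar> < \<eta>1 \<Longrightarrow> b < \<bar>poly u s\<bar>"
    unfolding eventually_at by (auto simp: dist_real_def)
  have "bounded ((\<lambda>z. poly2 R (fst z) (snd z)) ` ({0..1} \<times> {0..1}))"
    by (intro compact_imp_bounded compact_continuous_image continuous_on_subset[OF continuous_on_poly2] compact_Times) auto
  then obtain M where M: "M > 0" "\<And>t s. 0 \<le> t \<Longrightarrow> t \<le> 1 \<Longrightarrow> 0 \<le> s \<Longrightarrow> s \<le> 1 \<Longrightarrow> \<bar>poly2 R t s\<bar> \<le> M"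
    unfolding bounded_pos by force
  \<comment> \<open>The natural exponent is \<open>k\<close>; raising it to \<open>k + 2\<close>
    ensures \<open>m \<ge> 2\<close> and costs nothing because \<open>s < 1\<close>.\<close>
  have "s ^ (k + 2) \<le> (M / b) * t"
    if t: "0 < t" "t < min 1 \<eta>1" and s: "0 < s" "s < min 1 \<eta>1" and z: "poly2 Q t s = 0" for t s
  proof -
    have "poly2 Q' t s = 0" using z t unfolding Q'(1) by (simp add: poly_power)
    then have "s ^ k * poly u s = - t * poly2 R t s" unfolding cR u(1) by (simp add: poly_power)
    then have "s ^ k * \<bar>poly u s\<bar> = t * \<bar>poly2 R t s\<bar>" using s t
      by (metis abs_minus abs_mult abs_of_pos mult_minus_left power_abs)
    moreover have "t * \<bar>poly2 R t s\<bar> \<le> t * M" using M(2)[of t s] t s by simp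
    moreover have "s ^ k * b \<le> s ^ k * \<bar>poly u s\<bar>" using \<eta>1(2)[of s] s by simp
    ultimately have "s ^ k * b \<le> M * t" by (simp add: mult.commute)
    then have "s ^ k \<le> (M / b) * t" using b by (simp add: field_simps)
    moreover have "s ^ (k + 2) \<le> s ^ k" using s by (intro power_decreasing) auto
    ultimately show ?thesis by linarith
  qed
  moreover have "M / b > 0" "min 1 \<eta>1 > 0" using M b \<eta>1 by auto
  ultimately show ?thesis by (intro exI[of _ "k + 2"] conjI exI[of _ "M / b"] exI[of _ "min 1 \<eta>1"]) auto
qed

lemma isCont_tendsto_nhds: "isCont f x \<Longrightarrow> (f \<longlongrightarrow> f x) (nhds x)"
  by (simp only: isCont_def tendsto_at_iff_tendsto_nhds)

lemma eventually_sgn_eq: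
  fixes f :: "real \<Rightarrow> real"
  assumes "isCont f a" "f a \<noteq> 0"
  shows "\<forall>\<^sub>F s in nhds a. sgn (f s) = sgn (f a)"
proof -
  note lim = isCont_tendsto_nhds[OF assms(1)]
  show ?thesis
  proof (cases "f a > 0")
    case True
    from order_tendstoD(1)[OF lim this] show ?thesis by eventually_elim (use True in simp)
  next
    case False
    then have "f a < 0" using assms(2) by simp
    from order_tendstoD(2)[OF lim this] show ?thesis by eventually_elim (use \<open>f a < 0\<close> in simp)
  qed
qed

text \<open>At the supremum of the fibre \<open>{s. U t s}\<close> membership changes, so there some nonzero \<open>Q\<close> vanishes.\<close>

lemma definable_fibre_growth:
  fixes U :: "real \<Rightarrow> real \<Rightarrow> bool" and \<Q> :: "real poly poly set"
  assumes fin: "finite \<Q>"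
    and det: "\<And>t s s'. (\<forall>Q\<in>\<Q>. sgn (poly2 Q t s) = sgn (poly2 Q t s')) \<Longrightarrow> U t s \<longleftrightarrow> U t s'"
    and pos: "\<And>t s. U t s \<Longrightarrow> 0 < s"
    and down: "\<And>t s s'. U t s \<Longrightarrow> 0 < s' \<Longrightarrow> s' \<le> s \<Longrightarrow> U t s'"
    and small: "\<And>\<epsilon>. 0 < \<epsilon> \<Longrightarrow> \<exists>\<delta>>0. \<forall>t s. 0 < t \<and> t < \<delta> \<and> U t s \<longrightarrow> s < \<epsilon>"
  shows "\<exists>m\<ge>2. \<exists>K>0. \<exists>\<delta>>0. \<forall>t s. 0 < t \<and> t < \<delta> \<and> U t s \<longrightarrow> s ^ m \<le> K * t"
proof -
  \<comment> \<open>The zero polynomial has constant sign and cannot detect a change of membership,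
    so it is left out; the product then stays nonzero.\<close>
  define Q where "Q = \<Prod>(\<Q> - {0})"
  have "Q \<noteq> 0" using fin by (simp add: Q_def)
  from poly2_zero_growth[OF this] obtain m K \<eta> where m: "m \<ge> 2" "K > 0" "\<eta> > 0"
    "\<forall>t s. 0 < t \<and> t < \<eta> \<and> 0 < s \<and> s < \<eta> \<and> poly2 Q t s = 0 \<longrightarrow> s ^ m \<le> K * t" by blast
  \<comment> \<open>The bound \<open>\<eta> / 2\<close> keeps the supremum of the fibre strictly
    below \<open>\<eta>\<close>.\<close>
  obtain \<delta> where \<delta>: "\<delta> > 0" "\<And>t s. 0 < t \<Longrightarrow> t < \<delta> \<Longrightarrow> U t s \<Longrightarrow> s < \<eta> / 2"
    using small[of "\<eta> / 2"] m(3) by (meson half_gt_zero)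
  have "s ^ m \<le> K * t" if t: "0 < t" "t < min \<delta> \<eta>" and s: "U t s" for t s
  proof -
    define \<phi> where "\<phi> = Sup {s. U t s}"
    have bdd: "bdd_above {s. U t s}" using \<delta>(2)[of t] t by (intro bdd_aboveI[of _ "\<eta> / 2"]) force
    have s\<phi>: "s \<le> \<phi>" unfolding \<phi>_def using bdd s by (intro cSup_upper) auto
    have "\<phi> \<le> \<eta> / 2" unfolding \<phi>_def using \<delta>(2)[of t] t s by (intro cSup_least) force+
    then have \<phi>: "0 < \<phi>" "\<phi> < \<eta>" using pos[OF s] s\<phi> m(3) by auto
    have below: "U t s'" if s': "0 < s'" "s' < \<phi>" for s'
    proof -
      obtain s'' where "s'' \<in> {s. U t s}" "s' < s''"
        using less_cSup_iff[OF _ bdd, of s'] s'(2) s unfolding \<phi>_def by blast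
      then show ?thesis using down[of t s'' s'] s'(1) by simp
    qed
    have above: "\<not> U t s'" if "\<phi> < s'" for s'
      using cSup_upper[OF _ bdd, of s'] that unfolding \<phi>_def[symmetric] by auto
    have "poly2 Q t \<phi> = 0"
    proof (rule ccontr)
      assume "poly2 Q t \<phi> \<noteq> 0"
      then have nz: "poly2 q t \<phi> \<noteq> 0" if "q \<in> \<Q>" "q \<noteq> 0" for q
        using that fin unfolding Q_def poly_prod by auto
      have "\<forall>\<^sub>F s in nhds \<phi>. \<forall>q\<in>\<Q>. sgn (poly2 q t s) = sgn (poly2 q t \<phi>)"
      proof (intro eventually_ball_finite[OF fin] ballI)
        fix q assume q: "q \<in> \<Q>"
        show "\<forall>\<^sub>F s in nhds \<phi>. sgn (poly2 q t s) = sgn (poly2 q t \<phi>)"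
        proof (cases "q = 0")
          case False
          then show ?thesis using nz[OF q] by (intro eventually_sgn_eq) auto
        qed simp
      qed
      then obtain e where e: "e > 0" "\<And>s. dist s \<phi> < e \<Longrightarrow> \<forall>q\<in>\<Q>. sgn (poly2 q t s) = sgn (poly2 q t \<phi>)"
        unfolding eventually_nhds_metric by blast
      \<comment> \<open>The points \<open>\<phi> - e'\<close> and \<open>\<phi> + e'\<close> carry
        equal signs but lie on different sides of the boundary of the fibre;
        \<open>e' \<le> \<phi> / 2\<close> keeps the lower one positive.\<close>
      define e' where "e' = min (e / 2) (\<phi> / 2)"
      have e': "0 < e'" "e' < e" "e' < \<phi>" using e \<phi> by (auto simp: e'_def)
      have "\<forall>q\<in>\<Q>. sgn (poly2 q t (\<phi> - e')) = sgn (poly2 q t (\<phi> + e'))"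
        using e(2)[of "\<phi> - e'"] e(2)[of "\<phi> + e'"] e' by (simp add: dist_real_def)
      from det[OF this] show False using below[of "\<phi> - e'"] above[of "\<phi> + e'"] e' by simp
    qed
    then have "\<phi> ^ m \<le> K * t" using m(4)[rule_format, of t \<phi>] t \<phi> by simp
    moreover have "s ^ m \<le> \<phi> ^ m" using s\<phi> pos[OF s] by (intro power_mono) auto
    ultimately show ?thesis by linarith
  qed
  moreover have "min \<delta> \<eta> > 0" using \<delta> m by simp
  ultimately show ?thesis using m(1,2) by blast
qed

section \<open>Formal derivatives, polynomials vanishing on open sets, continuity\<close>

lemma lookup_partial_poly:
  "Poly_Mapping.lookup (partial_poly i P) m =
    real (Poly_Mapping.lookup m i + 1) * Poly_Mapping.lookup P (m + Poly_Mapping.single i 1)"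
proof -
  let ?e = "Poly_Mapping.single i (1::nat)"
  have "Poly_Mapping.lookup (partial_poly i P) m = (\<Sum>k\<in>Poly_Mapping.keys P.
      if k = m + ?e then real (Poly_Mapping.lookup k i) * Poly_Mapping.lookup P k else 0)"
    unfolding partial_poly_def lookup_sum lookup_single
  proof (intro sum.cong refl)
    fix k
    show "(real (Poly_Mapping.lookup k i) * Poly_Mapping.lookup P k when k - ?e = m) =
      (if k = m + ?e then real (Poly_Mapping.lookup k i) * Poly_Mapping.lookup P k else 0)"
    proof (cases "Poly_Mapping.lookup k i = 0")
      case True
      then show ?thesis by (auto simp: when_def)
    next
      case False
      then have "k = (k - ?e) + ?e"
        by (intro poly_mapping_eqI) (auto simp: lookup_add lookup_minus lookup_single when_def)
      then have "k - ?e = m \<longleftrightarrow> k = m + ?e" by auto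
      then show ?thesis by (simp add: when_def)
    qed
  qed
  then show ?thesis
    by (simp add: sum.delta lookup_add in_keys_iff)
qed

lemma grad_poly_eq_0_if_open:
  assumes "open U" "x \<in> U" "\<And>y. y \<in> U \<Longrightarrow> eval_poly P y = 0"
  shows "grad_poly P x = 0"
proof -
  have "((\<lambda>_. 0) has_derivative (\<lambda>h. h \<bullet> grad_poly P x)) (at x)"
    using eval_poly_GDERIV[of P x] assms unfolding gderiv_def
    by (rule has_derivative_transform_within_open) auto
  from has_derivative_unique[OF this has_derivative_const]
  have "h \<bullet> grad_poly P x = 0" for h by meson
  from this[of "grad_poly P x"] show ?thesis by simp
qed

text \<open>Induction on a bound for the total degree: the partial derivatives vanish on
  \<open>U\<close> too, so they are zero polynomials. This leaves only the constant coefficient,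
  which is the value at \<open>x\<close>.\<close>

lemma rpoly_eq_0_if_open:
  fixes P :: "'n::finite rpoly"
  assumes U: "open U" "x \<in> U" and zero: "\<And>y. y \<in> U \<Longrightarrow> eval_poly P y = 0"
  shows "P = 0"
proof -
  have *: "P = 0" if "\<And>m. m \<in> Poly_Mapping.keys P \<Longrightarrow> (\<Sum>i\<in>UNIV. Poly_Mapping.lookup m i) < d"
    and "\<And>y. y \<in> U \<Longrightarrow> eval_poly P y = 0" for d and P :: "'n rpoly"
    using that
  proof (induction d arbitrary: P)
    case 0
    then have "Poly_Mapping.keys P = {}" by blast
    then show ?case by simp
  next
    case (Suc d)
    have partial: "partial_poly i P = 0" for i
    proof (rule Suc.IH)
      fix m assume "m \<in> Poly_Mapping.keys (partial_poly i P)"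
      then have "m + Poly_Mapping.single i 1 \<in> Poly_Mapping.keys P"
        by (auto simp: in_keys_iff lookup_partial_poly)
      from Suc.prems(1)[OF this] show "(\<Sum>i\<in>UNIV. Poly_Mapping.lookup m i) < d"
        by (simp add: lookup_add sum.distrib lookup_single when_def)
    next
      fix y assume "y \<in> U"
      then have "grad_poly P y = 0" using grad_poly_eq_0_if_open[OF U(1)] Suc.prems(2) by blast
      then show "eval_poly (partial_poly i P) y = 0" by (simp add: grad_poly_def vec_eq_iff)
    qed
    have nz: "Poly_Mapping.lookup P m = 0" if m: "m \<noteq> 0" for m
    proof -
      obtain i where i: "Poly_Mapping.lookup m i \<noteq> 0" using m poly_mapping_eqI[of m 0] by auto
      let ?e = "Poly_Mapping.single i (1::nat)"
      have "m = (m - ?e) + ?e"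
        using i by (intro poly_mapping_eqI) (auto simp: lookup_add lookup_minus lookup_single when_def)
      then show ?thesis using lookup_partial_poly[of i P "m - ?e"] by (simp add: partial)
    qed
    have P: "P = Poly_Mapping.single 0 (Poly_Mapping.lookup P 0)"
      by (rule poly_mapping_eqI) (auto simp: lookup_single when_def nz)
    have "eval_poly P x = Poly_Mapping.lookup P 0"
      by (subst P) simp
    then show ?case using Suc.prems(2)[OF U(2)] P by simp
  qed
  obtain d where "\<forall>k\<in>(\<lambda>m. \<Sum>i\<in>UNIV. Poly_Mapping.lookup m i) ` Poly_Mapping.keys P. k < d"
    using finite_nat_set_iff_bounded by (metis finite_imageI finite_keys)
  then show ?thesis using *[of P d] zero by auto
qed

lemma isCont_eval_poly: "isCont (eval_poly P) x"
  using eval_poly_GDERIV[of P x] unfolding gderiv_def by (rule has_derivative_continuous)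

lemma continuous_on_eval_poly: "continuous_on S (eval_poly P)"
  by (intro continuous_at_imp_continuous_on ballI isCont_eval_poly)

lemma eval_poly_mem_polyfuns:
  assumes "\<And>i. \<iota> i \<in> V"
  shows "(\<lambda>e. eval_poly P (\<chi> i. e (\<iota> i))) \<in> polyfuns V"
  unfolding eval_poly_def eval_monom_def
  by (intro pf.sum pf.mult pf.const pf.prod pf.power) (simp add: polyfuns.var assms)

text \<open>Membership of \<open>(t, s)\<close> in \<open>U\<close> is semialgebraic by projection; its fibre over \<open>t\<close> is the
  set of positive values bounded by those of the quotient on \<open>{T \<le> t}\<close>.\<close>

lemma quotient_growth:
  fixes A B T :: "'n::finite rpoly" and g :: "real ^ 'n \<Rightarrow> real"
  assumes \<rho>: "\<rho> \<ge> 0"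
    and cont: "continuous_on (cball x0 \<rho>) g"
    and g: "\<And>x. eval_poly B x \<noteq> 0 \<Longrightarrow> g x = eval_poly A x / eval_poly B x"
    and B: "\<And>x. eval_poly B x \<ge> 0" and T: "\<And>x. eval_poly T x \<ge> 0"
    and zero: "\<And>x. x \<in> cball x0 \<rho> \<Longrightarrow> eval_poly T x = 0 \<Longrightarrow> g x \<le> 0"
  shows "\<exists>m\<ge>2. \<exists>K>0. \<exists>\<delta>>0. \<forall>x\<in>cball x0 \<rho>. 0 < eval_poly T x \<and> eval_poly T x < \<delta> \<and>
    eval_poly B x \<noteq> 0 \<and> 0 < g x \<longrightarrow> g x ^ m \<le> K * eval_poly T x"
proof -
  \<comment> \<open>One environment holds all variables: \<open>Inl i\<close> the coordinates of the
    point, \<open>Inr True\<close> the bound \<open>t\<close> and \<open>Inr False\<close> the value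
    \<open>s\<close>.\<close>
  define pt :: "('n + bool \<Rightarrow> real) \<Rightarrow> real ^ 'n" where "pt e = (\<chi> i. e (Inl i))" for e
  let ?t = "\<lambda>e::'n + bool \<Rightarrow> real. e (Inr True)" and ?s = "\<lambda>e::'n + bool \<Rightarrow> real. e (Inr False)"
  \<comment> \<open>Clearing the positive denominator and squaring the distance turns all
    requirements into polynomial inequalities.\<close>
  define S where "S = {e. 0 < ?s e} \<inter> ({e. 0 \<le> ?t e - eval_poly T (pt e)} \<inter> ({e. 0 < eval_poly B (pt e)}
    \<inter> ({e. 0 \<le> eval_poly A (pt e) - ?s e * eval_poly B (pt e)}
    \<inter> {e. 0 \<le> \<rho>\<^sup>2 - (\<Sum>i\<in>UNIV. (e (Inl i) - x0 $ i)\<^sup>2)})))"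
  have ev: "(\<lambda>e. eval_poly Q (pt e)) \<in> polyfuns UNIV" for Q
    unfolding pt_def by (rule eval_poly_mem_polyfuns) simp
  have v: "(\<lambda>e. e w) \<in> polyfuns UNIV" for w :: "'n + bool"
    by (rule polyfuns.var) simp
  have "sign_definable (polyfuns UNIV) S"
    unfolding S_def
    by (intro sign_definable_Int sign_definable_pos sign_definable_nonneg pf.diff pf.mult pf.sum pf.power ev v polyfuns.const)
  from sign_definable_projection_finite[OF _ this, of "range Inl"]
  obtain C where C: "finite C" "C \<subseteq> polyfuns (UNIV - range Inl)"
    and Cdet: "\<forall>x y. (\<forall>b\<in>C. sgn (b x) = sgn (b y)) \<longrightarrow>
      (x \<in> {e. \<exists>e'\<in>S. \<forall>v. v \<notin> range Inl \<longrightarrow> e' v = e v} \<longleftrightarrow> y \<in> {e. \<exists>e'\<in>S. \<forall>v. v \<notin> range Inl \<longrightarrow> e' v = e v})"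
    unfolding sign_definable_def by auto
  \<comment> \<open>The coordinates are set to 0 arbitrarily, since the projection disregards
    them.\<close>
  define env :: "real \<Rightarrow> real \<Rightarrow> 'n + bool \<Rightarrow> real" where
    "env t s v = (case v of Inl _ \<Rightarrow> 0 | Inr b \<Rightarrow> if b then t else s)" for t s v
  define U where "U t s \<longleftrightarrow> 0 < s \<and> (\<exists>x\<in>cball x0 \<rho>. eval_poly T x \<le> t \<and> 0 < eval_poly B x \<and> s * eval_poly B x \<le> eval_poly A x)" for t s
  have cb: "x \<in> cball x0 \<rho> \<longleftrightarrow> (\<Sum>i\<in>UNIV. (x $ i - x0 $ i)\<^sup>2) \<le> \<rho>\<^sup>2" for x
  proof -
    have "x \<in> cball x0 \<rho> \<longleftrightarrow> (norm (x - x0))\<^sup>2 \<le> \<rho>\<^sup>2"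
      using \<rho> by (simp add: dist_norm norm_minus_commute abs_le_square_iff[symmetric])
    then show ?thesis unfolding power2_norm_eq_inner by (simp add: inner_vec_def power2_eq_square)
  qed
  have Ueq: "env t s \<in> {e. \<exists>e'\<in>S. \<forall>v. v \<notin> range Inl \<longrightarrow> e' v = e v} \<longleftrightarrow> U t s" for t s
  proof
    assume "env t s \<in> {e. \<exists>e'\<in>S. \<forall>v. v \<notin> range Inl \<longrightarrow> e' v = e v}"
    then obtain e' where e': "e' \<in> S" "\<forall>v. v \<notin> range Inl \<longrightarrow> e' v = env t s v" by blast
    have ts: "?t e' = t" "?s e' = s" using e'(2)[rule_format, of "Inr True"] e'(2)[rule_format, of "Inr False"]
      by (auto simp: env_def)
    have "pt e' \<in> cball x0 \<rho>" using e'(1) unfolding cb by (simp add: S_def pt_def)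
    then show "U t s" using e'(1) ts unfolding U_def by (intro conjI bexI[of _ "pt e'"]) (auto simp: S_def)
  next
    assume "U t s"
    then obtain x where x: "0 < s" "x \<in> cball x0 \<rho>" "eval_poly T x \<le> t" "0 < eval_poly B x" "s * eval_poly B x \<le> eval_poly A x"
      unfolding U_def by blast
    define e' where "e' v = (case v of Inl i \<Rightarrow> x $ i | Inr b \<Rightarrow> if b then t else s)" for v
    have "pt e' = x" by (simp add: pt_def e'_def vec_eq_iff)
    then have "e' \<in> S" using x unfolding S_def cb by (simp add: e'_def)
    moreover have "\<forall>v. v \<notin> range Inl \<longrightarrow> e' v = env t s v"
      by (auto simp: e'_def env_def split: sum.split)
    ultimately show "env t s \<in> {e. \<exists>e'\<in>S. \<forall>v. v \<notin> range Inl \<longrightarrow> e' v = e v}" by blast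
  qed
  have "UNIV - range Inl \<subseteq> {Inr True, Inr False :: 'n + bool}"
  proof
    fix v :: "'n + bool" assume "v \<in> UNIV - range Inl"
    then show "v \<in> {Inr True, Inr False}" by (cases v) auto
  qed
  then have "\<forall>b\<in>C. \<exists>Q. \<forall>e. b e = poly2 Q (?t e) (?s e)"
    using C(2) polyfuns_pair by (metis (no_types, lifting) subsetD)
  from bchoice[OF this] obtain Q where Q: "\<forall>b\<in>C. \<forall>e. b e = poly2 (Q b) (?t e) (?s e)" ..
  have "\<exists>m\<ge>2. \<exists>K>0. \<exists>\<delta>>0. \<forall>t s. 0 < t \<and> t < \<delta> \<and> U t s \<longrightarrow> s ^ m \<le> K * t"
  proof (rule definable_fibre_growth)
    show "finite (Q ` C)" using C(1) by simp
  next
    fix t s s' assume *: "\<forall>q\<in>Q ` C. sgn (poly2 q t s) = sgn (poly2 q t s')"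
    have "\<forall>b\<in>C. sgn (b (env t s)) = sgn (b (env t s'))"
    proof
      fix b assume b: "b \<in> C"
      have "b (env t u) = poly2 (Q b) t u" for u using bspec[OF Q b, rule_format, of "env t u"] by (simp add: env_def)
      then show "sgn (b (env t s)) = sgn (b (env t s'))" using * b by simp
    qed
    then show "U t s \<longleftrightarrow> U t s'" using Cdet unfolding Ueq[symmetric] by blast
  next
    show "0 < s" if "U t s" for t s using that by (simp add: U_def)
  next
    fix t s s' assume U: "U t s" and s': "0 < s'" "s' \<le> s"
    then obtain x where x: "x \<in> cball x0 \<rho>" "eval_poly T x \<le> t" "0 < eval_poly B x" "s * eval_poly B x \<le> eval_poly A x"
      unfolding U_def by blast
    have "s' * eval_poly B x \<le> s * eval_poly B x" using s' x by (intro mult_right_mono) auto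
    then have "s' * eval_poly B x \<le> eval_poly A x" using x by linarith
    then show "U t s'" using x s' unfolding U_def by blast
  next
    fix \<epsilon> :: real assume \<epsilon>: "0 < \<epsilon>"
    \<comment> \<open>Continuity of \<open>g\<close> makes this set compact, and \<open>T\<close>
      has no zero on it by assumption. The positive minimum of \<open>T\<close> on it is the
      required \<open>\<delta>\<close>.\<close>
    define Z where "Z = {x \<in> cball x0 \<rho>. \<epsilon> \<le> g x}"
    have Z: "Z = cball x0 \<rho> \<inter> g -` {\<epsilon>..}" by (auto simp: Z_def)
    have "closed Z"
      unfolding Z using cont by (rule continuous_closed_preimage) auto
    moreover have "bounded Z"
      using bounded_cball by (rule bounded_subset) (auto simp: Z_def)
    ultimately have "compact Z" by (simp add: compact_eq_bounded_closed)
    have "\<exists>\<delta>>0. \<forall>x\<in>Z. \<delta> \<le> eval_poly T x"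
    proof (cases "Z = {}")
      case False
      obtain z where z: "z \<in> Z" "\<forall>x\<in>Z. eval_poly T z \<le> eval_poly T x"
        using continuous_attains_inf[OF \<open>compact Z\<close> False continuous_on_eval_poly] by blast
      have "eval_poly T z \<noteq> 0" using zero[of z] z(1) \<epsilon> unfolding Z_def by force
      then have "0 < eval_poly T z" using T[of z] by simp
      then show ?thesis using z by blast
    qed (auto intro: exI[of _ 1])
    then obtain \<delta> where \<delta>: "\<delta> > 0" "\<forall>x\<in>Z. \<delta> \<le> eval_poly T x" by blast
    have "s < \<epsilon>" if t: "t < \<delta>" and U: "U t s" for t s
    proof -
      obtain x where x: "x \<in> cball x0 \<rho>" "eval_poly T x \<le> t" "0 < eval_poly B x" "s * eval_poly B x \<le> eval_poly A x"
        using U unfolding U_def by blast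
      have "x \<notin> Z" using \<delta>(2) x(2) t by force
      then have "g x < \<epsilon>" using x(1) unfolding Z_def by simp
      moreover have "s \<le> g x" using x g[of x] by (simp add: pos_le_divide_eq)
      ultimately show ?thesis by linarith
    qed
    then show "\<exists>\<delta>>0. \<forall>t s. 0 < t \<and> t < \<delta> \<and> U t s \<longrightarrow> s < \<epsilon>" using \<delta>(1) by blast
  qed
  then obtain m K \<delta> where m: "m \<ge> 2" "K > 0" "\<delta> > 0" "\<forall>t s. 0 < t \<and> t < \<delta> \<and> U t s \<longrightarrow> s ^ m \<le> K * t" by blast
  have "g x ^ m \<le> K * eval_poly T x" if x: "x \<in> cball x0 \<rho>" "0 < eval_poly T x" "eval_poly T x < \<delta>" "eval_poly B x \<noteq> 0" "0 < g x" for x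
  proof -
    have "0 < eval_poly B x" using B[of x] x by simp
    then have "U (eval_poly T x) (g x)" unfolding U_def using x g[of x] by (intro conjI bexI[of _ x]) auto
    then show ?thesis using m(4) x by blast
  qed
  then show ?thesis using m(1-3) by blast
qed

section \<open>Lojasiewicz exponents\<close>

lemma powr_ratio_power:
  fixes a :: real
  assumes "0 \<le> a" "0 < p" "0 < q"
  shows "(a powr (real p / real q)) ^ (2 * q) = a ^ (2 * p)"
proof (cases "a = 0")
  case False
  then have "(a powr (real p / real q)) ^ (2 * q) = a powr (real (2 * p))"
    using assms by (simp add: powr_powr mult.commute[of _ 2] flip: powr_realpow)
  then show ?thesis using False assms(1) by (subst powr_realpow[symmetric]) auto
qed (use assms in \<open>simp add: power_0_left\<close>)

text \<open>Clear the denominator, cancel the factor \<open>a\<^sup>2\<close>, which lowers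
  \<open>2 * p * m\<close> to \<open>2 * (p * m - 1)\<close>, and take the root of order
  \<open>2 * q * m\<close>.\<close>

lemma powr_exponent_ratio:
  fixes a K N :: real
  assumes a: "0 < a" and N: "0 < N" and K: "0 < K" and pq: "0 < p" "0 < q" and m: "2 \<le> m"
    and le: "(a ^ (2 * p) / N ^ (2 * q)) ^ m \<le> K * a\<^sup>2"
  shows "a powr (real (p * m - 1) / real (q * m)) \<le> K powr (1 / real (2 * q * m)) * N"
proof -
  have pm: "p * m \<ge> 1" using pq m by (simp add: Suc_le_eq)
  have "a ^ (2 * p * m) \<le> K * a\<^sup>2 * N ^ (2 * q * m)"
    using le N by (simp add: power_divide power_mult[symmetric] pos_divide_le_eq)
  moreover have "a ^ (2 * p * m) = a\<^sup>2 * a ^ (2 * (p * m - 1))"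
  proof -
    have "2 * p * m = 2 + 2 * (p * m - 1)" using pm by (simp only: mult.assoc)
    then show ?thesis by (metis power_add)
  qed
  ultimately have "a\<^sup>2 * a ^ (2 * (p * m - 1)) \<le> a\<^sup>2 * (K * N ^ (2 * q * m))" by (simp add: ac_simps)
  then have "a ^ (2 * (p * m - 1)) \<le> K * N ^ (2 * q * m)" using a by simp
  then have "(a ^ (2 * (p * m - 1))) powr (1 / real (2 * q * m)) \<le> (K * N ^ (2 * q * m)) powr (1 / real (2 * q * m))"
    using a by (intro powr_mono2) auto
  also have "\<dots> = K powr (1 / real (2 * q * m)) * N"
  proof -
    have "(N ^ (2 * q * m)) powr (1 / real (2 * q * m)) = N powr (real (2 * q * m) * (1 / real (2 * q * m)))"
      using N by (simp only: powr_realpow[symmetric] powr_powr)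
    also have "\<dots> = N" using N pq m by simp
    finally show ?thesis using K N by (simp add: powr_mult)
  qed
  also have "(a ^ (2 * (p * m - 1))) powr (1 / real (2 * q * m)) = a powr (real (p * m - 1) / real (q * m))"
  proof -
    have "(a ^ (2 * (p * m - 1))) powr (1 / real (2 * q * m)) = a powr (real (2 * (p * m - 1)) * (1 / real (2 * q * m)))"
      using a by (simp only: powr_realpow[symmetric] powr_powr)
    also have "real (2 * (p * m - 1)) * (1 / real (2 * q * m)) = real (p * m - 1) / real (q * m)"
      by simp
    finally show ?thesis .
  qed
  finally show ?thesis .
qed

text \<open>Continuity allows \<open>quotient_growth\<close> to be applied with
  \<open>T = P\<^sup>2\<close>, and \<open>powr_exponent_ratio\<close> converts the resulting bound
  into a Lojasiewicz inequality with a smaller exponent.\<close>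

lemma loj_exponent_improvement:
  fixes P :: "'n::finite rpoly" and g :: "real ^ 'n \<Rightarrow> real"
  assumes P0: "eval_poly P x0 = 0" and pq: "0 < p" "0 < q" and r: "0 < r"
    and crit: "\<And>x. x \<in> ball x0 r \<Longrightarrow> grad_poly P x = 0 \<Longrightarrow> eval_poly P x = 0"
    and g: "\<And>x. g x = (if grad_poly P x \<noteq> 0
                  then (eval_poly P x) ^ (2 * p) / norm (grad_poly P x) ^ (2 * q) else 0)"
    and cont: "continuous_on (ball x0 r) g"
  shows "loj_exponent P x0 < real p / real q"
proof -
  define \<rho> where "\<rho> = r / 2"
  have \<rho>: "0 < \<rho>" "cball x0 \<rho> \<subseteq> ball x0 r" using r by (auto simp: \<rho>_def)
  have ev: "eval_poly (grad_sq_poly P ^ q) x = norm (grad_poly P x) ^ (2 * q)" for x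
    by (simp add: eval_grad_sq_poly power_mult)
  have "\<exists>m\<ge>2. \<exists>K>0. \<exists>\<delta>>0. \<forall>x\<in>cball x0 \<rho>. 0 < eval_poly (P\<^sup>2) x \<and> eval_poly (P\<^sup>2) x < \<delta> \<and>
    eval_poly (grad_sq_poly P ^ q) x \<noteq> 0 \<and> 0 < g x \<longrightarrow> g x ^ m \<le> K * eval_poly (P\<^sup>2) x"
  proof (rule quotient_growth)
    show "continuous_on (cball x0 \<rho>) g" using cont \<rho>(2) by (rule continuous_on_subset)
    show "g x = eval_poly (P ^ (2 * p)) x / eval_poly (grad_sq_poly P ^ q) x"
      if "eval_poly (grad_sq_poly P ^ q) x \<noteq> 0" for x
      using that pq unfolding ev g by simp
    show "g x \<le> 0" if "eval_poly (P\<^sup>2) x = 0" for x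
      using that pq unfolding g by (simp add: power_0_left)
  qed (use \<rho> in \<open>auto simp: eval_grad_sq_poly\<close>)
  then obtain m K \<delta> where m: "m \<ge> 2" "K > 0" "\<delta> > 0"
    and grow: "\<forall>x\<in>cball x0 \<rho>. 0 < eval_poly (P\<^sup>2) x \<and> eval_poly (P\<^sup>2) x < \<delta> \<and>
    eval_poly (grad_sq_poly P ^ q) x \<noteq> 0 \<and> 0 < g x \<longrightarrow> g x ^ m \<le> K * eval_poly (P\<^sup>2) x" by blast
  have "(eval_poly (P\<^sup>2) \<longlongrightarrow> eval_poly (P\<^sup>2) x0) (nhds x0)"
    by (rule isCont_tendsto_nhds[OF isCont_eval_poly])
  then have "\<forall>\<^sub>F x in nhds x0. eval_poly (P\<^sup>2) x < \<delta>"
    by (rule order_tendstoD) (use P0 m in simp)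
  then obtain e where e: "e > 0" "\<And>x. dist x x0 < e \<Longrightarrow> eval_poly (P\<^sup>2) x < \<delta>"
    unfolding eventually_nhds_metric by blast
  define \<theta> where "\<theta> = real (p * m - 1) / real (q * m)"
  \<comment> \<open>Here \<open>m \<ge> 2\<close> matters: it makes \<open>p * m - 1\<close> and
    thereby the new exponent positive.\<close>
  have pm: "p * m \<ge> 2" using pq m(1) mult_le_mono[of 1 p 2 m] by simp
  have "\<bar>eval_poly P x\<bar> powr \<theta> \<le> K powr (1 / real (2 * q * m)) * norm (grad_poly P x)"
    if x: "norm (x - x0) < min e \<rho>" for x
  proof (cases "eval_poly P x = 0")
    case False
    have xc: "x \<in> cball x0 \<rho>" using x by (simp add: dist_norm norm_minus_commute)
    have gr: "grad_poly P x \<noteq> 0" using crit[of x] False xc \<rho>(2) by blast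
    have gx: "g x = \<bar>eval_poly P x\<bar> ^ (2 * p) / norm (grad_poly P x) ^ (2 * q)"
      using gr unfolding g by (simp add: power_mult)
    have "0 < eval_poly (P\<^sup>2) x \<and> eval_poly (P\<^sup>2) x < \<delta> \<and> eval_poly (grad_sq_poly P ^ q) x \<noteq> 0 \<and> 0 < g x"
      using e(2)[of x] x False gr unfolding ev gx by (simp add: dist_norm)
    then have "g x ^ m \<le> K * \<bar>eval_poly P x\<bar>\<^sup>2" using grow xc by fastforce
    then show ?thesis
      unfolding \<theta>_def gx using False gr m pq by (intro powr_exponent_ratio) auto
  qed (use m in simp)
  moreover have "\<theta> > 0"
    unfolding \<theta>_def using pm pq m by (intro divide_pos_pos) (simp_all only: of_nat_0_less_iff, simp_all)
  moreover have "min e \<rho> > 0" "K powr (1 / real (2 * q * m)) > 0" using e \<rho> m by auto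
  ultimately have "\<theta> \<in> loj_exponents P x0" unfolding loj_exponents_def by blast
  moreover have "bdd_below (loj_exponents P x0)"
    by (rule bdd_belowI[of _ 0]) (auto simp: loj_exponents_def)
  ultimately have "loj_exponent P x0 \<le> \<theta>" unfolding loj_exponent_def by (rule cInf_lower)
  moreover have "\<theta> < real p / real q"
  proof -
    have "\<theta> < real (p * m) / real (q * m)"
      unfolding \<theta>_def using pm pq m by (intro divide_strict_right_mono) auto
    then show ?thesis using m by simp
  qed
  ultimately show ?thesis by linarith
qed

section \<open>Boundedness and continuity of the two quotients\<close>

theorem theorem7p4:
  fixes P N D :: "'n::finite rpoly" and x0 :: "real ^ 'n"
    and p q :: nat and r C :: real
    and f g :: "real ^ 'n \<Rightarrow> real"
  assumes "P \<noteq> 0"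
    and "eval_poly P x0 = 0" and "norm (grad_poly P x0) = 0"
    and "p > 0" and "q > 0"
    and "real p / real q \<in> loj_exponents P x0"
    and "r > 0" and "C > 0"
    and "\<forall>x. norm (x - x0) < r \<longrightarrow>
           \<bar>eval_poly P x\<bar> powr (real p / real q) \<le> C * norm (grad_poly P x)"
    and "is_reduced_form (P ^ (2 * p)) (grad_sq_poly P ^ q) N D"
    and "f = (\<lambda>x. if x \<notin> zero_locus D then eval_poly N x / eval_poly D x else 0)"
    and "g = (\<lambda>x. if grad_poly P x \<noteq> 0
                  then (eval_poly P x) ^ (2 * p) / norm (grad_poly P x) ^ (2 * q) else 0)"
  shows "bounded (f ` ball x0 r) \<and> bounded (g ` ball x0 r)
    \<and> (real p / real q > loj_exponent P x0 \<longrightarrow>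
         (\<exists>r'>0. r' \<le> r \<and> (\<forall>x\<in>ball x0 r'. f x = g x) \<and>
            continuous_on (ball x0 r') f \<and> continuous_on (ball x0 r') g))
    \<and> (real p / real q = loj_exponent P x0 \<longrightarrow>
         (\<forall>r'>0. \<not> continuous_on (ball x0 r') g))
    \<and> (real p / real q = loj_exponent P x0 \<and> x0 isolated_in {x. grad_poly P x = 0} \<and>
         eval_poly D x0 = 0 \<longrightarrow>
         (\<forall>r'>0. \<not> continuous_on (ball x0 r') f))"
proof -
  note f = assms(11) and g = assms(12)
  define \<theta> where "\<theta> = real p / real q"
  have \<theta>: "\<theta> > 0" using assms(4,5) by (simp add: \<theta>_def)
  let ?n = "\<lambda>x. norm (grad_poly P x)"
  have loj: "\<bar>eval_poly P x\<bar> powr \<theta> \<le> C * ?n x" if "x \<in> ball x0 r" for x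
    using assms(9) that by (simp add: \<theta>_def dist_norm norm_minus_commute)
  have crit: "eval_poly P x = 0" if "x \<in> ball x0 r" "grad_poly P x = 0" for x
    using loj[OF that(1)] that(2) by simp
  obtain F where F: "P ^ (2 * p) = F * N" "grad_sq_poly P ^ q = F * D"
    using assms(10) unfolding is_reduced_form_def by (elim exE conjE) (rule that)
  have FN: "eval_poly P x ^ (2 * p) = eval_poly F x * eval_poly N x" for x
    using arg_cong[OF F(1), of "\<lambda>Q. eval_poly Q x"] by simp
  have FD: "?n x ^ (2 * q) = eval_poly F x * eval_poly D x" for x
    using arg_cong[OF F(2), of "\<lambda>Q. eval_poly Q x"] by (simp add: eval_grad_sq_poly power_mult)
  \<comment> \<open>Off the critical set both \<open>F\<close> and \<open>D\<close> are nonzero, so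
    the common factor \<open>F\<close> cancels.\<close>
  have fg: "f x = g x" if "grad_poly P x \<noteq> 0" for x
  proof -
    have "eval_poly F x * eval_poly D x \<noteq> 0" using that FD[of x, symmetric] by simp
    then show ?thesis using that unfolding f g by (simp add: FN FD zero_locus_def)
  qed
  \<comment> \<open>If all of \<open>V\<close> were critical, the inequality would make
    \<open>P\<close> vanish on an open set.\<close>
  have dense: "\<exists>y\<in>V. grad_poly P y \<noteq> 0" if "open V" "x \<in> V" "V \<subseteq> ball x0 r" for V x
  proof (rule ccontr)
    assume "\<not> ?thesis"
    then have "\<And>y. y \<in> V \<Longrightarrow> eval_poly P y = 0" using that(3) crit by blast
    from rpoly_eq_0_if_open[OF that(1,2) this] show False using assms(1) by simp
  qed
  have D_open: "open {x. eval_poly D x \<noteq> 0}"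
    using continuous_on_eval_poly[of UNIV D] by (intro open_Collect_neq continuous_on_const)
  have f_cont: "isCont f x" if "eval_poly D x \<noteq> 0" for x
  proof -
    have "\<forall>\<^sub>F y in nhds x. eval_poly N y / eval_poly D y = f y"
      unfolding eventually_nhds using D_open that
      by (intro exI[of _ "{x. eval_poly D x \<noteq> 0}"]) (auto simp: f zero_locus_def)
    moreover have "isCont (\<lambda>y. eval_poly N y / eval_poly D y) x"
      using that by (intro isCont_divide isCont_eval_poly)
    ultimately show ?thesis using isCont_cong by fast
  qed
  have g_bound: "\<bar>g x\<bar> \<le> C ^ (2 * q)" if "x \<in> ball x0 r" for x
  proof (cases "grad_poly P x = 0")
    case False
    have "(\<bar>eval_poly P x\<bar> powr \<theta>) ^ (2 * q) \<le> (C * ?n x) ^ (2 * q)"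
      using loj[OF that] by (intro power_mono) auto
    then have "\<bar>eval_poly P x\<bar> ^ (2 * p) \<le> C ^ (2 * q) * ?n x ^ (2 * q)"
      unfolding \<theta>_def using assms(4,5) by (simp add: powr_ratio_power power_mult_distrib)
    then have "eval_poly P x ^ (2 * p) \<le> C ^ (2 * q) * ?n x ^ (2 * q)"
      by (simp add: power_mult)
    moreover have "0 \<le> eval_poly P x ^ (2 * p)" by (simp add: power_mult)
    ultimately show ?thesis using False unfolding g by (simp add: pos_divide_le_eq)
  qed (use assms(8) in \<open>simp add: g\<close>)
  \<comment> \<open>Where \<open>D\<close> is nonzero, \<open>f\<close> is continuous and equals
    \<open>g\<close> on a dense set, so the bound for \<open>g\<close> carries over.\<close>
  have f_bound: "\<bar>f x\<bar> \<le> C ^ (2 * q)" if x: "x \<in> ball x0 r" for x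
  proof (cases "eval_poly D x = 0")
    case False
    show ?thesis
    proof (rule ccontr)
      assume "\<not> ?thesis"
      then have "C ^ (2 * q) < \<bar>f x\<bar>" by simp
      moreover have "((\<lambda>y. \<bar>f y\<bar>) \<longlongrightarrow> \<bar>f x\<bar>) (nhds x)"
        by (intro tendsto_rabs isCont_tendsto_nhds f_cont[OF False])
      ultimately have "\<forall>\<^sub>F y in nhds x. C ^ (2 * q) < \<bar>f y\<bar>" by (intro order_tendstoD(1))
      then obtain V where V: "open V" "x \<in> V" "\<forall>y\<in>V. C ^ (2 * q) < \<bar>f y\<bar>"
        unfolding eventually_nhds by blast
      then obtain y where "y \<in> V \<inter> ball x0 r" "grad_poly P y \<noteq> 0"
        using dense[of "V \<inter> ball x0 r" x] x by blast
      then show False using V(3) fg[of y] g_bound[of y] by force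
    qed
  qed (use assms(8) in \<open>simp add: f zero_locus_def\<close>)
  have "bounded (f ` ball x0 r)" using f_bound by (intro boundedI) auto
  moreover have "bounded (g ` ball x0 r)" using g_bound by (intro boundedI) auto
  moreover have "\<exists>r'>0. r' \<le> r \<and> (\<forall>x\<in>ball x0 r'. f x = g x) \<and>
            continuous_on (ball x0 r') f \<and> continuous_on (ball x0 r') g"
    if gt: "real p / real q > loj_exponent P x0"
  proof -
    obtain \<theta>1 where \<theta>1: "\<theta>1 \<in> loj_exponents P x0" "\<theta>1 < \<theta>"
      using cInf_lessD[of "loj_exponents P x0" \<theta>] gt assms(6) unfolding loj_exponent_def \<theta>_def by blast
    then obtain r1 C1 where r1: "r1 > 0" "C1 > 0" "\<theta>1 > 0"
      "\<And>x. norm (x - x0) < r1 \<Longrightarrow> \<bar>eval_poly P x\<bar> powr \<theta>1 \<le> C1 * ?n x"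
      unfolding loj_exponents_def by blast
    define r' where "r' = min r r1"
    \<comment> \<open>The exponent of \<open>P\<close> left over after
      \<open>2 * q * \<theta>1\<close> has been spent on the gradient; it is positive because
      \<open>\<theta>1 < \<theta>\<close>.\<close>
    define \<epsilon> where "\<epsilon> = real (2 * p) - \<theta>1 * real (2 * q)"
    have \<epsilon>: "\<epsilon> > 0" using \<theta>1(2) assms(5) by (simp add: \<epsilon>_def \<theta>_def pos_less_divide_eq)
    have decay: "\<bar>g x\<bar> \<le> C1 ^ (2 * q) * \<bar>eval_poly P x\<bar> powr \<epsilon>" if "x \<in> ball x0 r'" for x
    proof (cases "grad_poly P x = 0 \<or> eval_poly P x = 0")
      case True
      then show ?thesis using r1(2) assms(4) by (auto simp: g power_0_left)
    next
      case False
      then have pos: "0 < \<bar>eval_poly P x\<bar>" by simp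
      have "\<bar>eval_poly P x\<bar> powr \<theta>1 \<le> C1 * ?n x"
        using that by (intro r1(4)) (simp add: r'_def dist_norm norm_minus_commute)
      then have "(\<bar>eval_poly P x\<bar> powr \<theta>1) ^ (2 * q) \<le> (C1 * ?n x) ^ (2 * q)"
        by (intro power_mono) auto
      moreover have "(\<bar>eval_poly P x\<bar> powr \<theta>1) ^ (2 * q) = \<bar>eval_poly P x\<bar> powr (\<theta>1 * real (2 * q))"
        using pos by (subst powr_realpow[symmetric]) (simp_all add: powr_powr)
      ultimately have "\<bar>eval_poly P x\<bar> powr (\<theta>1 * real (2 * q)) \<le> C1 ^ (2 * q) * ?n x ^ (2 * q)"
        by (simp add: power_mult_distrib)
      then have "\<bar>eval_poly P x\<bar> powr \<epsilon> * \<bar>eval_poly P x\<bar> powr (\<theta>1 * real (2 * q))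
        \<le> \<bar>eval_poly P x\<bar> powr \<epsilon> * (C1 ^ (2 * q) * ?n x ^ (2 * q))"
        by (intro mult_left_mono) auto
      moreover have "\<bar>eval_poly P x\<bar> powr \<epsilon> * \<bar>eval_poly P x\<bar> powr (\<theta>1 * real (2 * q)) = \<bar>eval_poly P x\<bar> powr real (2 * p)"
        by (simp add: \<epsilon>_def flip: powr_add)
      moreover have "\<bar>eval_poly P x\<bar> powr real (2 * p) = eval_poly P x ^ (2 * p)"
        by (subst powr_realpow[OF pos]) (simp add: power_mult)
      ultimately have "eval_poly P x ^ (2 * p) \<le> (C1 ^ (2 * q) * \<bar>eval_poly P x\<bar> powr \<epsilon>) * ?n x ^ (2 * q)"
        by (simp add: ac_simps)
      moreover have "0 \<le> eval_poly P x ^ (2 * p)" by (simp add: power_mult)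
      ultimately show ?thesis using False unfolding g by (simp add: pos_divide_le_eq)
    qed
    \<comment> \<open>At a critical point \<open>P\<close> vanishes and \<open>decay\<close>
      squeezes \<open>g\<close> to its default value 0; elsewhere the denominator is
      nonzero.\<close>
    have g_cont: "isCont g x" if x: "x \<in> ball x0 r'" for x
    proof (cases "grad_poly P x = 0")
      case True
      have Px: "eval_poly P x = 0" using crit[of x] True x by (simp add: r'_def)
      have "((\<lambda>y. \<bar>eval_poly P y\<bar>) \<longlongrightarrow> 0) (at x)"
        using isCont_eval_poly[of x P] Px by (simp add: isCont_def tendsto_rabs_zero)
      then have "((\<lambda>y. \<bar>eval_poly P y\<bar> powr \<epsilon>) \<longlongrightarrow> 0) (at x)"
        using \<epsilon> by (intro tendsto_zero_powrI[where b = \<epsilon>]) auto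
      then have lim: "((\<lambda>y. C1 ^ (2 * q) * \<bar>eval_poly P y\<bar> powr \<epsilon>) \<longlongrightarrow> 0) (at x)"
        by (intro tendsto_mult_right_zero)
      have "\<forall>\<^sub>F y in at x. norm (g y) \<le> C1 ^ (2 * q) * \<bar>eval_poly P y\<bar> powr \<epsilon>"
        using eventually_at_in_open'[OF open_ball x] by eventually_elim (use decay in simp)
      from Lim_null_comparison[OF this lim] show ?thesis using True by (simp add: isCont_def g)
    next
      case False
      have "isCont (grad_poly P) x"
        unfolding isCont_def grad_poly_def
        by (intro tendsto_vec_lambda isCont_eval_poly[unfolded isCont_def])
      then have n: "isCont ?n x" by (intro continuous_norm)
      have "\<forall>\<^sub>F y in nhds x. ?n y \<noteq> 0"
        by (rule tendsto_imp_eventually_ne[OF isCont_tendsto_nhds[OF n]]) (use False in simp)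
      then have "\<forall>\<^sub>F y in nhds x. eval_poly P y ^ (2 * p) / ?n y ^ (2 * q) = g y"
        by eventually_elim (simp add: g)
      moreover have "isCont (\<lambda>y. eval_poly P y ^ (2 * p) / ?n y ^ (2 * q)) x"
        using False n by (intro isCont_divide isCont_power isCont_eval_poly) auto
      ultimately show ?thesis using isCont_cong by fast
    qed
    have eq: "f x = g x" if x: "x \<in> ball x0 r'" for x
    \<comment> \<open>At a critical point with \<open>D\<close> nonzero both functions are
      continuous and agree on a dense set. If \<open>D\<close> also vanishes, both take the default
      value 0.\<close>
    proof (cases "grad_poly P x = 0 \<and> eval_poly D x \<noteq> 0")
      case True
      show ?thesis
      proof (rule ccontr)
        assume "f x \<noteq> g x"
        moreover have "((\<lambda>y. f y - g y) \<longlongrightarrow> f x - g x) (nhds x)"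
          using True by (intro tendsto_diff isCont_tendsto_nhds f_cont g_cont[OF x]) simp
        ultimately have "\<forall>\<^sub>F y in nhds x. f y - g y \<noteq> 0"
          by (intro tendsto_imp_eventually_ne) auto
        then obtain V where V: "open V" "x \<in> V" "\<forall>y\<in>V. f y - g y \<noteq> 0"
          unfolding eventually_nhds by blast
        then obtain y where "y \<in> V \<inter> ball x0 r" "grad_poly P y \<noteq> 0"
          using dense[of "V \<inter> ball x0 r" x] x
          by (metis Int_iff Int_lower2 open_Int open_ball mem_ball min_less_iff_conj r'_def)
        then show False using V(3) fg[of y] by force
      qed
    next
      case False
      then show ?thesis using fg[of x] by (auto simp: f g zero_locus_def)
    qed
    have "continuous_on (ball x0 r') g"
      using g_cont by (intro continuous_at_imp_continuous_on) blast
    moreover have "continuous_on (ball x0 r') f"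
      by (rule continuous_on_eq[OF calculation]) (simp add: eq)
    moreover have "r' > 0" "r' \<le> r" using r1 assms(7) by (auto simp: r'_def)
    ultimately show ?thesis using eq by blast
  qed
  moreover have g_discont: "\<not> continuous_on (ball x0 r') g"
    if "real p / real q = loj_exponent P x0" "r' > 0" for r'
  proof
    assume cont: "continuous_on (ball x0 r') g"
    have "loj_exponent P x0 < real p / real q"
    proof (rule loj_exponent_improvement[OF assms(2,4,5)])
      \<comment> \<open>The smaller ball is needed because critical points are known to be zeros of
        \<open>P\<close> only within radius \<open>r\<close>.\<close>
      show "0 < min r r'" using assms(7) that by simp
      show "eval_poly P x = 0" if "x \<in> ball x0 (min r r')" "grad_poly P x = 0" for x
        using crit[of x] that by simp
      show "continuous_on (ball x0 (min r r')) g"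
        using cont by (rule continuous_on_subset) auto
    qed (simp add: g)
    then show False using that by simp
  qed
  moreover have "\<not> continuous_on (ball x0 r') f"
    if eq: "real p / real q = loj_exponent P x0" and iso: "x0 isolated_in {x. grad_poly P x = 0}"
      and D0: "eval_poly D x0 = 0" and r': "r' > 0" for r'
  proof
    assume cont: "continuous_on (ball x0 r') f"
    obtain V where V: "open V" "V \<inter> {x. grad_poly P x = 0} = {x0}"
      using iso unfolding isolated_in_def by blast
    then have "x0 \<in> V" by blast
    with V(1) obtain e where e: "e > 0" "ball x0 e \<subseteq> V" by (rule openE)
    \<comment> \<open>At \<open>x0\<close> both functions have the default value 0; the other points
      of the ball are not critical by isolation.\<close>
    have fg_eq: "f x = g x" if "x \<in> ball x0 (min e r')" for x
    proof (cases "x = x0")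
      case True
      then show ?thesis using D0 assms(3) by (simp add: f g zero_locus_def)
    next
      case False
      then have "grad_poly P x \<noteq> 0" using V e that by auto
      then show ?thesis by (rule fg)
    qed
    have "continuous_on (ball x0 (min e r')) f"
      using cont by (rule continuous_on_subset) auto
    then have "continuous_on (ball x0 (min e r')) g"
      by (rule continuous_on_eq) (rule fg_eq)
    then show False using g_discont[OF eq, of "min e r'"] e r' by simp
  qed
  ultimately show ?thesis by blast
qed

end
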